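(* Let $\{(X_i,Y_i)\}_{i=1}^n$ be i.i.d. with $Y_i=f_0(X_i)+\xi_i$ and $\mathbb{E}[\xi_i\mid X_i]=0$. Assume: (A) $\mathbb{E}[|\xi_i|^m]<\infty$ for some $m>1$, and, with $\kappa\in(0,1]$ defined by $m\wedge2=1+\kappa$, $\|\mathbb{E}[|\xi_i|^{1+\kappa}\mid X_i]\|_{L^\infty}<\infty$. (B) The candidate classes $\mathcal{F}_n$ satisfy: (B1) $\mathcal{F}_n\cup\{f_0\}$ is uniformly bounded by some $M>0$; (B2) there exist $D_{\mathcal{F}_n}\ge1$ and $\gamma\ge0$ such that, up to logarithmic factors, $\log N(x,\mathcal{F}_n,L^\infty)\le D_{\mathcal{F}_n}x^{-\gamma}$ for all $x>0$, i.e. there are constants $C_0>0$, $U\ge1$, $a_0\ge0$ with $\log N(x,\mathcal{F}_n,L^\infty)\le C_0D_{\mathcal{F}_n}x^{-\gamma}(\log_+(U/x))^{a_0}$ for all $x>0$; (B3) there is $s\in[0,1]$ and a constant $C_1$ such that for any $f_n^\ast\in\mathcal{F}_n$ and any subset $\mathcal{G}\subseteq\mathcal{F}_n-\{f_n^\ast\}:=\{f-f_n^\ast:f\in\mathcal{F}_n\}$, the envelope function $F_{\mathcal{G}}$ of $\mathcal{G}$ satisfies $\|F_{\mathcal{G}}\|_{L^\infty}\le C_1\sup_{f\in\mathcal{G}}\|f\|_{L^2(P)}^s$. Let $\tilde n=n/D_{\mathcal{F}_n}$ and let $\hat f_n\in\arg\min_{f\in\mathcal{F}_n}\frac1n\sum_{i=1}^n(Y_i-f(X_i))^2$.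 Then there exist constants $C>0$ and $a\ge0$, not depending on $n$ or $D_{\mathcal{F}_n}$, such that $$\mathbb{E}\|\hat f_n-f_0\|_{L^2(P)}\le C(\log_+ n)^a\Bigl[\tilde n^{-\left(\frac{1}{2+\gamma}\wedge\frac{1}{2\gamma}\right)}+\tilde n^{-\left(\frac{2-s}{1-1/m}+s\gamma\right)^{-1}}+\inf_{f\in\mathcal{F}_n}\|f-f_0\|_{L^2(P)}\Bigr].$$
   Context: $a\wedge b$ is the minimum, with $\frac1{2\gamma}=+\infty$ when $\gamma=0$; $\log_+(x)=1\vee\log x$. $P$ is the common law of the data; $\|g\|_{L^2(P)}^2=\mathbb{E}[g(X)^2]$ for an independent copy $X$ of $X_1$. The envelope function of $\mathcal{G}$ is $F_{\mathcal{G}}(x)=\sup_{g\in\mathcal{G}}|g(x)|$. For a metric $d$, a set $K$ and $h>0$, $N(h,K,d)$ is the smallest cardinality of a subset $C\subseteq K$ such that every point of $K$ is within distance at most $h$ of a point of $C$; $L^\infty$ denotes the uniform norm metric. The class $\mathcal{F}_n$ and $D_{\mathcal{F}_n}$ may vary with $n$; the constants $m,M,\gamma,s$ and the implied constants in the assumptions do not. *)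

theory Defs
  imports "HOL-Probability.Probability"
begin

definition log_plus :: "real \<Rightarrow> real" where
  "log_plus x = max 1 (ln x)"

text \<open>Real powers with the analytic convention \<open>0\<close> to the \<open>0\<close> equals \<open>1\<close>; the library's
  \<open>powr\<close> has \<open>0 powr 0 = 0\<close>.\<close>

definition rpow :: "real \<Rightarrow> real \<Rightarrow> real" where
  "rpow x s = (if s = 0 then 1 else x powr s)"

definition L2_norm :: "'x measure \<Rightarrow> ('x \<Rightarrow> real) \<Rightarrow> real" where
  "L2_norm P g = sqrt (\<integral>x. (g x)\<^sup>2 \<partial>P)"

text \<open>The genuine supremum over the space, not an essential supremum.\<close>

definition unif_norm :: "'x set \<Rightarrow> ('x \<Rightarrow> ereal) \<Rightarrow> ereal" where
  "unif_norm A g = (SUP x\<in>A. \<bar>g x\<bar>)"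

definition unif_dist :: "'x set \<Rightarrow> ('x \<Rightarrow> real) \<Rightarrow> ('x \<Rightarrow> real) \<Rightarrow> ereal" where
  "unif_dist A f g = unif_norm A (\<lambda>x. ereal (f x - g x))"

definition envelope :: "('x \<Rightarrow> real) set \<Rightarrow> 'x \<Rightarrow> ereal" where
  "envelope G x = (SUP g\<in>G. ereal \<bar>g x\<bar>)"

text \<open>Covers are centred in \<open>K\<close>. The number is \<open>\<infinity>\<close> when there is no finite cover, so that an upper
  bound on the entropy includes total boundedness.\<close>

definition covering_number :: "real \<Rightarrow> 'a set \<Rightarrow> ('a \<Rightarrow> 'a \<Rightarrow> ereal) \<Rightarrow> enat" where
  "covering_number h K d =
     (INF C\<in>{C. C \<subseteq> K \<and> (\<forall>k\<in>K. \<exists>c\<in>C. d k c \<le> ereal h)}.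
        if finite C then enat (card C) else \<infinity>)"

definition covering_entropy :: "real \<Rightarrow> 'a set \<Rightarrow> ('a \<Rightarrow> 'a \<Rightarrow> ereal) \<Rightarrow> ereal" where
  "covering_entropy h K d =
     (case covering_number h K d of enat N \<Rightarrow> ereal (ln (real N)) | \<infinity> \<Rightarrow> \<infinity>)"

definition empirical_risk ::
  "nat \<Rightarrow> (nat \<Rightarrow> 'x) \<Rightarrow> (nat \<Rightarrow> real) \<Rightarrow> ('x \<Rightarrow> real) \<Rightarrow> real" where
  "empirical_risk n x y f = (1 / real n) * (\<Sum>i<n. (y i - f (x i))\<^sup>2)"

definition sigma_gen :: "'w measure \<Rightarrow> 'x measure \<Rightarrow> ('w \<Rightarrow> 'x) \<Rightarrow> 'w measure" where
  "sigma_gen \<Omega> S Z = vimage_algebra (space \<Omega>) Z S"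

definition iid :: "'w measure \<Rightarrow> 'z measure \<Rightarrow> (nat \<Rightarrow> 'w \<Rightarrow> 'z) \<Rightarrow> bool" where
  "iid \<Omega> T Z \<longleftrightarrow> prob_space.indep_vars \<Omega> (\<lambda>_. T) Z UNIV \<and>
     (\<forall>i j. distr \<Omega> T (Z i) = distr \<Omega> T (Z j))"

text \<open>The minimum of \<open>1 / (2 + \<gamma>)\<close> and \<open>1 / (2 * \<gamma>)\<close>, where \<open>1 / (2 * \<gamma>)\<close> is read as \<open>\<infinity>\<close> for
  \<open>\<gamma> = 0\<close> (in the library, \<open>1 / 0 = 0\<close>).\<close>

definition entropy_exponent :: "real \<Rightarrow> real" where
  "entropy_exponent \<gamma> = (if \<gamma> = 0 then 1 / (2 + \<gamma>) else min (1 / (2 + \<gamma>)) (1 / (2 * \<gamma>)))"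

definition unif_bounded_class :: "'x set \<Rightarrow> real \<Rightarrow> ('x \<Rightarrow> real) set \<Rightarrow> bool" where
  "unif_bounded_class A M F \<longleftrightarrow> (\<forall>f\<in>F. \<forall>x\<in>A. \<bar>f x\<bar> \<le> M)"

definition entropy_condition ::
  "'x set \<Rightarrow> real \<Rightarrow> real \<Rightarrow> real \<Rightarrow> real \<Rightarrow> ('x \<Rightarrow> real) set \<Rightarrow> real \<Rightarrow> bool" where
  "entropy_condition A \<gamma> C0 U a0 F D \<longleftrightarrow>
     (\<forall>x>0. covering_entropy x F (unif_dist A)
              \<le> ereal (C0 * D * x powr (- \<gamma>) * log_plus (U / x) powr a0))"

text \<open>The supremum of \<open>L2\<close> norms is a supremum of reals, so it is only meaningful for nonempty
  \<open>G\<close>. It is bounded when \<open>F\<close> is uniformly bounded.\<close>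

definition envelope_condition ::
  "'x measure \<Rightarrow> real \<Rightarrow> real \<Rightarrow> ('x \<Rightarrow> real) set \<Rightarrow> bool" where
  "envelope_condition P s C1 F \<longleftrightarrow>
     (\<forall>fs\<in>F. \<forall>G. G \<noteq> {} \<and> G \<subseteq> (\<lambda>f x. f x - fs x) ` F \<longrightarrow>
        unif_norm (space P) (envelope G) \<le> ereal (C1 * rpow (SUP g\<in>G. L2_norm P g) s))"

end

theory Submission
  imports Defs
begin

text \<open>Fix \<open>fs\<close> in the class and write \<open>l f (x, y) = (y - f x)\<^sup>2 - (y - fs x)\<^sup>2\<close>. Since the noise is conditionally centred,
  the mean of \<open>l f\<close> is \<open>\<parallel>f - f0\<parallel>\<^sup>2 - \<parallel>fs - f0\<parallel>\<^sup>2\<close>, and the empirical mean of \<open>l (fhat \<omega>)\<close> is at most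
  \<open>0\<close>. So the squared error of the estimator exceeds that of \<open>fs\<close> by at most the deviation of the empirical mean
  of \<open>l (fhat \<omega>)\<close> from its mean, and everything reduces to a bound on that deviation, uniform over an \<open>L\<^sup>2\<close>
  ball of radius \<open>t\<close> around \<open>fs\<close>.

  Let \<open>\<delta>\<close> be the sum of the two rates. The heart of the proof (\<open>localised_deviation\<close>) is that, for
  \<open>t \<ge> \<delta>\<close>, this uniform deviation has expectation at most a power of \<open>log n\<close> times \<open>t * \<delta>\<close>. It is
  obtained by chaining in the uniform norm. The envelope condition confines the ball to a uniform ball of radius of
  order \<open>t powr s\<close>, which is the coarsest scale; the finest scale is \<open>t * \<delta>\<close>, where the remainder can
  be bounded trivially. The loss is Lipschitz in \<open>f\<close> with the random multiplier \<open>2 \<bar>\<xi>\<bar> + 4 M\<close>. For the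
  finitely many links at scale \<open>x\<close>, whose log-cardinality is \<open>n \<rho>\<close> with \<open>\<rho>\<close> about
  \<open>D x powr (-\<gamma>) / n\<close>, the multiplier is truncated at \<open>\<rho> powr (-1/m)\<close>. The truncated part obeys a
  Bernstein-type maximal inequality and the rest is controlled by the moment of order \<open>m\<close>; both contribute \<open>x \<rho> powr (1 - 1/m)\<close>,
  up to the variance term \<open>min t x * sqrt \<rho>\<close> of Bernstein's inequality (\<open>heavy_tailed_maximal_inequality\<close>). For
  \<open>m < 2\<close> that variance term is absorbed in the first one; for \<open>m \<ge> 2\<close> it needs the bounded conditional
  variance.

  As functions of \<open>x\<close> both bounds are powers on each side of \<open>t\<close>, so they are largest at an end point. The
  finest scale gives the exponent \<open>1/(2\<gamma>)\<close>, the scale \<open>x = t\<close> of the variance term gives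
  \<open>1/(2+\<gamma>)\<close>, and the coarsest scale \<open>t powr s\<close> of the truncation term gives the heavy-tail rate
  (\<open>scale_bound\<close>, \<open>variance_scale_bound\<close>). Bounding each of the \<open>O(log n)\<close> links by the worst one
  costs only a logarithm and avoids all case distinctions on summability.

  Finally the range of \<open>\<parallel>fhat \<omega> - fs\<parallel>\<close> is cut into dyadic shells \<open>t = 2 ^ k * \<delta>\<close>
  (\<open>peeling\<close>). On such a shell the comparison of squared errors reads \<open>t\<^sup>2 \<lesssim> \<parallel>fs - f0\<parallel>\<^sup>2 + V\<close> with \<open>V\<close> the deviation, so
  \<open>t \<lesssim> \<parallel>fs - f0\<parallel> + V / t\<close>, and \<open>V / t\<close> has expectation of order \<open>\<delta>\<close> up to logarithms.
  Summation over the \<open>O(log n)\<close> shells and the infimum over \<open>fs\<close> give the claim.\<close>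

section \<open>Maximal inequalities and chaining for an i.i.d. sample\<close>

lemma exp_le_quadratic:
  fixes u :: real
  assumes "\<bar>u\<bar> \<le> 1"
  shows "exp u \<le> 1 + u + u\<^sup>2"
proof (cases "u \<ge> 0")
  case True
  then show ?thesis using assms by (intro exp_bound) auto
next
  case False
  define w where "w = - u"
  have w: "w \<ge> 0" "w \<le> 1" using False assms by (auto simp: w_def)
  have "1 \<le> (1 - w + w\<^sup>2) * (1 + w + w\<^sup>2 / 2)"
  proof -
    have "(1 - w + w\<^sup>2) * (1 + w + w\<^sup>2 / 2) = 1 + w^2/2 + w^3/2 + w^4/2"
      by (simp add: field_simps power2_eq_square power3_eq_cube power4_eq_xxxx)
    then show ?thesis using w by simp
  qed
  also have "\<dots> \<le> (1 - w + w\<^sup>2) * exp w"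
    using w by (intro mult_left_mono exp_lower_Taylor_quadratic) auto
  finally have "exp (- w) \<le> 1 - w + w\<^sup>2"
    by (simp add: exp_minus field_simps)
  then show ?thesis by (simp add: w_def)
qed

locale iid_sample = prob_space \<Omega> for \<Omega> :: "'w measure" +
  fixes T :: "'z measure" and Z :: "nat \<Rightarrow> 'w \<Rightarrow> 'z"
  assumes indep: "indep_vars (\<lambda>_. T) Z UNIV"
    and same_law: "distr \<Omega> T (Z i) = distr \<Omega> T (Z j)"
begin

definition mean :: "('z \<Rightarrow> real) \<Rightarrow> real" where
  "mean h = expectation (\<lambda>\<omega>. h (Z 0 \<omega>))"

definition dev :: "nat \<Rightarrow> ('z \<Rightarrow> real) \<Rightarrow> 'w \<Rightarrow> real" where
  "dev n h \<omega> = (\<Sum>i<n. h (Z i \<omega>)) / real n - mean h"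

abbreviation integrable_obs :: "('z \<Rightarrow> real) \<Rightarrow> bool" where
  "integrable_obs h \<equiv> integrable \<Omega> (\<lambda>\<omega>. h (Z 0 \<omega>))"

lemma Z_measurable: "Z i \<in> \<Omega> \<rightarrow>\<^sub>M T"
  using indep by (auto simp: indep_vars_def)

lemma Z_space: "\<omega> \<in> space \<Omega> \<Longrightarrow> Z i \<omega> \<in> space T"
  by (rule measurable_space[OF Z_measurable])

lemma integrable_copy:
  assumes [measurable]: "h \<in> borel_measurable T" and "integrable_obs h"
  shows "integrable \<Omega> (\<lambda>\<omega>. h (Z i \<omega>))"
proof -
  note Z_measurable [measurable]
  have "integrable (distr \<Omega> T (Z 0)) h" using assms by (simp add: integrable_distr_eq)
  then have "integrable (distr \<Omega> T (Z i)) h" using same_law[of 0 i] by simp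
  then show ?thesis by (simp add: integrable_distr_eq)
qed

lemma expectation_copy:
  assumes [measurable]: "h \<in> borel_measurable T"
  shows "expectation (\<lambda>\<omega>. h (Z i \<omega>)) = mean h"
proof -
  note Z_measurable [measurable]
  have "integral\<^sup>L (distr \<Omega> T (Z i)) h = integral\<^sup>L (distr \<Omega> T (Z 0)) h"
    using same_law[of i 0] by simp
  then show ?thesis by (simp add: integral_distr mean_def)
qed

lemma integrable_bounded_obs:
  assumes [measurable]: "h \<in> borel_measurable T" and "\<And>z. z \<in> space T \<Longrightarrow> \<bar>h z\<bar> \<le> b"
  shows "integrable_obs h"
  by (rule integrable_const_bound[where B=b])
    (use assms Z_space measurable_compose[OF Z_measurable assms(1)] in auto)

lemma integrable_obs_bound:
  assumes [measurable]: "h \<in> borel_measurable T" and "integrable_obs k"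
    and "\<And>z. z \<in> space T \<Longrightarrow> \<bar>h z\<bar> \<le> k z"
  shows "integrable_obs h"
proof (rule Bochner_Integration.integrable_bound[OF assms(2)])
  show "AE \<omega> in \<Omega>. norm (h (Z 0 \<omega>)) \<le> norm (k (Z 0 \<omega>))"
  proof (rule AE_I2)
    fix \<omega> assume "\<omega> \<in> space \<Omega>"
    from assms(3)[OF Z_space[OF this, of 0]] show "norm (h (Z 0 \<omega>)) \<le> norm (k (Z 0 \<omega>))"
      by simp
  qed
qed (rule measurable_compose[OF Z_measurable assms(1)])

lemma mean_mono:
  assumes "integrable_obs h" "integrable_obs k" "\<And>z. z \<in> space T \<Longrightarrow> h z \<le> k z"
  shows "mean h \<le> mean k"
  unfolding mean_def using assms Z_space by (intro integral_mono) auto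

lemma dev_add:
  assumes "integrable_obs h" "integrable_obs k"
  shows "dev n (\<lambda>z. h z + k z) \<omega> = dev n h \<omega> + dev n k \<omega>"
  using assms by (simp add: dev_def mean_def sum.distrib add_divide_distrib)

lemma dev_sum:
  assumes "\<And>k. k \<in> A \<Longrightarrow> integrable_obs (h k)"
  shows "dev n (\<lambda>z. \<Sum>k\<in>A. h k z) \<omega> = (\<Sum>k\<in>A. dev n (h k) \<omega>)"
proof (cases "finite A")
  case True
  then show ?thesis using assms
  proof (induction A)
    case (insert x A)
    have "integrable_obs (\<lambda>z. \<Sum>k\<in>A. h k z)"
      using insert by (intro Bochner_Integration.integrable_sum) auto
    with insert show ?case by (simp add: dev_add)
  qed (simp add: dev_def mean_def)
qed (simp add: dev_def mean_def)

text \<open>The moment generating function behind Bernstein's inequality: on \<open>[-1, 1]\<close> the exponential is at most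
  \<open>1 + u + u\<^sup>2\<close>, so each centred summand contributes at most \<open>1 + l\<^sup>2 v\<close>, and independence multiplies
  the factors.\<close>

lemma exp_moment:
  assumes [measurable]: "h \<in> borel_measurable T"
    and bd: "\<And>z. z \<in> space T \<Longrightarrow> \<bar>h z\<bar> \<le> b / 2" and "b > 0"
    and v: "mean (\<lambda>z. (h z)\<^sup>2) \<le> v" and l: "\<bar>l\<bar> \<le> 1 / b" and "n \<ge> 1"
  shows "integrable \<Omega> (\<lambda>\<omega>. exp (l * real n * dev n h \<omega>))"
    and "expectation (\<lambda>\<omega>. exp (l * real n * dev n h \<omega>)) \<le> exp (real n * (l\<^sup>2 * v))"
proof -
  define \<mu> where "\<mu> = mean h"
  define e where "e z = exp (l * (h z - \<mu>))" for z
  have [measurable]: "e \<in> borel_measurable T" unfolding e_def by measurable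
  have int: "integrable_obs h" by (rule integrable_bounded_obs[OF _ bd]) auto
  have int2: "integrable_obs (\<lambda>z. (h z)\<^sup>2)"
  proof (rule integrable_bounded_obs[where b="(b/2)\<^sup>2"])
    fix z assume "z \<in> space T"
    then show "\<bar>(h z)\<^sup>2\<bar> \<le> (b/2)\<^sup>2" using bd[of z] by (simp add: abs_le_square_iff[symmetric])
  qed simp
  have mu: "\<bar>\<mu>\<bar> \<le> b / 2"
  proof -
    have "h z \<le> b / 2" "- (b / 2) \<le> h z" if "z \<in> space T" for z
      using bd[OF that] by linarith+
    then have "\<mu> \<le> mean (\<lambda>_. b / 2)" "mean (\<lambda>_. - (b / 2)) \<le> \<mu>" unfolding \<mu>_def
      using int by (auto intro!: mean_mono)
    then show ?thesis by (simp add: mean_def prob_space)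
  qed
  have small: "\<bar>l * (h z - \<mu>)\<bar> \<le> 1" if "z \<in> space T" for z
  proof -
    have "\<bar>l * (h z - \<mu>)\<bar> \<le> (1 / b) * b" unfolding abs_mult
      using l mu bd[OF that] \<open>b > 0\<close> by (intro mult_mono) auto
    then show ?thesis using \<open>b > 0\<close> by simp
  qed
  have e_bd: "\<bar>e z\<bar> \<le> exp 1" if "z \<in> space T" for z
    using small[OF that] by (simp add: e_def)
  have e_int: "integrable_obs e" by (rule integrable_bounded_obs[OF _ e_bd]) auto
  have "mean e \<le> mean (\<lambda>z. 1 + l * (h z - \<mu>) + (l * (h z - \<mu>))\<^sup>2)"
  proof (rule mean_mono[OF e_int])
    show "integrable_obs (\<lambda>z. 1 + l * (h z - \<mu>) + (l * (h z - \<mu>))\<^sup>2)"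
      using int int2 by (simp add: power2_eq_square algebra_simps)
    show "e z \<le> 1 + l * (h z - \<mu>) + (l * (h z - \<mu>))\<^sup>2" if "z \<in> space T" for z
      unfolding e_def by (rule exp_le_quadratic[OF small[OF that]])
  qed
  also have "\<dots> = 1 + l\<^sup>2 * (mean (\<lambda>z. (h z)\<^sup>2) - \<mu>\<^sup>2)"
  proof -
    have "(\<lambda>z. 1 + l * (h z - \<mu>) + (l * (h z - \<mu>))\<^sup>2)
        = (\<lambda>z. (1 - l * \<mu> + l\<^sup>2 * \<mu>\<^sup>2) + (l - 2 * l\<^sup>2 * \<mu>) * h z + l\<^sup>2 * (h z)\<^sup>2)"
      by (auto simp: power2_eq_square algebra_simps)
    then have "mean (\<lambda>z. 1 + l * (h z - \<mu>) + (l * (h z - \<mu>))\<^sup>2)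
        = (1 - l * \<mu> + l\<^sup>2 * \<mu>\<^sup>2) + (l - 2 * l\<^sup>2 * \<mu>) * \<mu> + l\<^sup>2 * mean (\<lambda>z. (h z)\<^sup>2)"
      using int int2 by (simp add: mean_def \<mu>_def prob_space)
    then show ?thesis by (simp add: power2_eq_square algebra_simps)
  qed
  also have "\<dots> \<le> 1 + l\<^sup>2 * v" 
    using v by (intro add_left_mono mult_left_mono) (auto intro: order_trans[of _ "mean (\<lambda>z. (h z)\<^sup>2)"])
  also have "\<dots> \<le> exp (l\<^sup>2 * v)" by simp
  finally have me: "mean e \<le> exp (l\<^sup>2 * v)" .
  have me0: "mean e \<ge> 0" unfolding mean_def e_def by simp
  have prod: "exp (l * real n * dev n h \<omega>) = (\<Prod>i<n. e (Z i \<omega>))" for \<omega>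
  proof -
    have "l * real n * dev n h \<omega> = (\<Sum>i<n. l * (h (Z i \<omega>) - \<mu>))"
      using \<open>n \<ge> 1\<close> by (simp add: dev_def \<mu>_def sum_subtractf sum_distrib_left[symmetric] field_simps)
    then show ?thesis by (simp add: exp_sum e_def)
  qed
  have ind: "indep_vars (\<lambda>_. borel) (\<lambda>i \<omega>. e (Z i \<omega>)) {..<n}"
    using indep_vars_compose2[OF indep, of "\<lambda>_. e" "\<lambda>_. borel"]
    by (auto intro: indep_vars_subset)
  have ints: "integrable \<Omega> (\<lambda>\<omega>. e (Z i \<omega>))" for i by (rule integrable_copy[OF _ e_int]) auto
  show "integrable \<Omega> (\<lambda>\<omega>. exp (l * real n * dev n h \<omega>))"
    unfolding prod by (rule indep_vars_integrable[OF _ ind ints]) auto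
  have "expectation (\<lambda>\<omega>. \<Prod>i<n. e (Z i \<omega>)) = (\<Prod>i<n. expectation (\<lambda>\<omega>. e (Z i \<omega>)))"
    by (rule indep_vars_lebesgue_integral[OF _ ind ints]) auto
  also have "\<dots> = mean e ^ n" by (simp add: expectation_copy)
  also have "\<dots> \<le> exp (l\<^sup>2 * v) ^ n" using me me0 by (rule power_mono)
  also have "\<dots> = exp (real n * (l\<^sup>2 * v))" by (simp add: exp_of_nat_mult)
  finally show "expectation (\<lambda>\<omega>. exp (l * real n * dev n h \<omega>)) \<le> exp (real n * (l\<^sup>2 * v))"
    unfolding prod .
qed

text \<open>The soft maximum \<open>s\<close> of all \<open>exp (\<plusminus> l n dev)\<close> dominates the exponential of the largest deviation. Instead of
  the logarithm of \<open>s\<close> its tangent at an upper bound \<open>a\<close> of the mean of \<open>s\<close> is used: the dominating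
  variable is then affine in \<open>s\<close>, so that neither its measurability nor its expectation needs Jensen's inequality.
  Throughout, a supremum over a class is replaced by an integrable dominating variable, which sidesteps the
  measurability of suprema.\<close>

lemma finite_maximal_inequality:
  fixes h :: "'j \<Rightarrow> 'z \<Rightarrow> real"
  assumes "finite J" "J \<noteq> {}"
    and [measurable]: "\<And>j. j \<in> J \<Longrightarrow> h j \<in> borel_measurable T"
    and bd: "\<And>j z. j \<in> J \<Longrightarrow> z \<in> space T \<Longrightarrow> \<bar>h j z\<bar> \<le> b / 2" and "b > 0"
    and v: "\<And>j. j \<in> J \<Longrightarrow> mean (\<lambda>z. (h j z)\<^sup>2) \<le> v" and "v > 0" and "n \<ge> 1"
    and r: "ln (2 * real (card J)) \<le> real n * \<rho>" and "\<rho> > 0"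
  shows "\<exists>V. integrable \<Omega> V \<and> (\<forall>j\<in>J. \<forall>\<omega>. \<bar>dev n (h j) \<omega>\<bar> \<le> V \<omega>) \<and>
      expectation V \<le> \<rho> * b + 2 * sqrt (\<rho> * v)"
proof -
  \<comment> \<open>the minimiser of \<open>\<rho> / l + l v\<close> subject to the constraint \<open>l \<le> 1 / b\<close> of \<open>exp_moment\<close>\<close>
  define l where "l = min (1 / b) (sqrt (\<rho> / v))"
  have l: "l > 0" "\<bar>l\<bar> \<le> 1 / b" "\<bar>- l\<bar> \<le> 1 / b"
    using \<open>b > 0\<close> \<open>v > 0\<close> \<open>\<rho> > 0\<close> by (auto simp: l_def)
  define s where "s \<omega> = (\<Sum>j\<in>J. exp (l * real n * dev n (h j) \<omega>) + exp (- l * real n * dev n (h j) \<omega>))" for \<omega>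
  define a where "a = 2 * real (card J) * exp (real n * (l\<^sup>2 * v))"
  have card: "card J > 0" using assms by (simp add: card_gt_0_iff)
  have a: "a > 0" using card by (simp add: a_def)
  have n: "real n > 0" using \<open>n \<ge> 1\<close> by simp
  have ie: "integrable \<Omega> (\<lambda>\<omega>. exp (l * real n * dev n (h j) \<omega>))"
      "integrable \<Omega> (\<lambda>\<omega>. exp (- l * real n * dev n (h j) \<omega>))" if "j \<in> J" for j
    using l that by (intro exp_moment(1)[OF _ bd \<open>b > 0\<close> v _ \<open>n \<ge> 1\<close>]; simp)+
  then have ints: "integrable \<Omega> s" unfolding s_def
    by (intro Bochner_Integration.integrable_sum Bochner_Integration.integrable_add)
  have "expectation s = (\<Sum>j\<in>J. expectation (\<lambda>\<omega>. exp (l * real n * dev n (h j) \<omega>))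
       + expectation (\<lambda>\<omega>. exp (- l * real n * dev n (h j) \<omega>)))" unfolding s_def
    using ie by (simp add: Bochner_Integration.integral_sum Bochner_Integration.integral_add
        del: mult_minus_left minus_mult_left)
  also have "\<dots> \<le> (\<Sum>j\<in>J. exp (real n * (l\<^sup>2 * v)) + exp (real n * ((- l)\<^sup>2 * v)))"
    using l by (intro sum_mono add_mono exp_moment(2)[OF _ bd \<open>b > 0\<close> v _ \<open>n \<ge> 1\<close>]) auto
  also have "\<dots> = a" by (simp add: a_def)
  finally have Es: "expectation s \<le> a" .
  define V where "V \<omega> = (ln a + s \<omega> / a - 1) / (l * real n)" for \<omega>
  have "integrable \<Omega> V" unfolding V_def using ints by simp
  moreover have "\<bar>dev n (h j) \<omega>\<bar> \<le> V \<omega>" if "j \<in> J" for j \<omega>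
  proof -
    have "exp (l * real n * \<bar>dev n (h j) \<omega>\<bar>)
        \<le> exp (l * real n * dev n (h j) \<omega>) + exp (- l * real n * dev n (h j) \<omega>)"
      by (cases "dev n (h j) \<omega> \<ge> 0") auto
    also have "\<dots> \<le> s \<omega>" unfolding s_def
      by (rule member_le_sum[OF that]) (use \<open>finite J\<close> in \<open>auto intro: add_nonneg_nonneg\<close>)
    finally have E: "exp (l * real n * \<bar>dev n (h j) \<omega>\<bar>) \<le> s \<omega>" .
    then have s0: "s \<omega> > 0" by (rule less_le_trans[rotated]) simp
    have "l * real n * \<bar>dev n (h j) \<omega>\<bar> \<le> ln (s \<omega>)" using E s0 by (simp add: ln_ge_iff)
    also have "\<dots> = ln a + ln (s \<omega> / a)" using s0 a by (simp add: ln_div)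
    also have "\<dots> \<le> ln a + (s \<omega> / a - 1)" using s0 a by (intro add_left_mono ln_le_minus_one) simp
    finally show ?thesis unfolding V_def using l n by (simp add: field_simps)
  qed
  moreover have "expectation V \<le> \<rho> * b + 2 * sqrt (\<rho> * v)"
  proof -
    have "expectation V = (ln a + expectation s / a - 1) / (l * real n)"
      unfolding V_def using ints by (simp add: prob_space)
    also have "\<dots> \<le> ln a / (l * real n)"
      using Es a l n by (intro divide_right_mono) auto
    also have "ln a = ln (2 * real (card J)) + real n * (l\<^sup>2 * v)"
      unfolding a_def using card by (subst ln_mult) auto
    also have "(\<dots>) / (l * real n) \<le> (real n * \<rho> + real n * (l\<^sup>2 * v)) / (l * real n)"
      using r l n by (intro divide_right_mono) auto
    also have "\<dots> = \<rho> * (1 / l) + l * v" using l n by (simp add: field_simps power2_eq_square)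
    also have "\<dots> \<le> \<rho> * (b + sqrt (v / \<rho>)) + sqrt (\<rho> / v) * v"
    proof (intro add_mono mult_left_mono mult_right_mono)
      show "1 / l \<le> b + sqrt (v / \<rho>)"
        using \<open>b > 0\<close> \<open>v > 0\<close> \<open>\<rho> > 0\<close> by (auto simp: l_def min_def real_sqrt_divide)
    qed (use \<open>v > 0\<close> \<open>\<rho> > 0\<close> in \<open>auto simp: l_def\<close>)
    also have "\<dots> = \<rho> * b + 2 * sqrt (\<rho> * v)"
    proof -
      have "\<rho> * sqrt (v / \<rho>) = sqrt (\<rho> * v)" "sqrt (\<rho> / v) * v = sqrt (\<rho> * v)"
        using \<open>v > 0\<close> \<open>\<rho> > 0\<close> by (simp_all add: real_sqrt_divide real_sqrt_mult field_simps)
      then show ?thesis by (simp add: algebra_simps)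
    qed
    finally show ?thesis .
  qed
  ultimately show ?thesis by blast
qed

lemma dev_dominated:
  assumes [measurable]: "e \<in> borel_measurable T" and "integrable_obs e" and "integrable_obs k"
    and ke: "\<And>z. z \<in> space T \<Longrightarrow> \<bar>k z\<bar> \<le> e z" and "\<omega> \<in> space \<Omega>"
  shows "\<bar>dev n k \<omega>\<bar> \<le> (\<Sum>i<n. e (Z i \<omega>)) / real n + mean e"
proof -
  have "\<bar>\<Sum>i<n. k (Z i \<omega>)\<bar> \<le> (\<Sum>i<n. e (Z i \<omega>))"
    using ke Z_space[OF \<open>\<omega> \<in> space \<Omega>\<close>] by (intro order_trans[OF sum_abs] sum_mono) auto
  then have "\<bar>(\<Sum>i<n. k (Z i \<omega>)) / real n\<bar> \<le> (\<Sum>i<n. e (Z i \<omega>)) / real n"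
    by (simp add: abs_divide divide_right_mono)
  moreover have "mean k \<le> mean e" "mean (\<lambda>z. - e z) \<le> mean k"
    using assms ke by (auto intro!: mean_mono simp: abs_le_iff) (smt (verit) ke)+
  then have "\<bar>mean k\<bar> \<le> mean e" by (auto simp: mean_def)
  ultimately show ?thesis unfolding dev_def by linarith
qed

lemma empirical_plus_mean:
  assumes [measurable]: "e \<in> borel_measurable T" and "integrable_obs e" and "n \<ge> 1"
  shows "integrable \<Omega> (\<lambda>\<omega>. (\<Sum>i<n. e (Z i \<omega>)) / real n + mean e)"
    and "expectation (\<lambda>\<omega>. (\<Sum>i<n. e (Z i \<omega>)) / real n + mean e) = 2 * mean e"
proof -
  have i: "integrable \<Omega> (\<lambda>\<omega>. e (Z i \<omega>))" for i by (rule integrable_copy) (use assms in auto)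
  show "integrable \<Omega> (\<lambda>\<omega>. (\<Sum>i<n. e (Z i \<omega>)) / real n + mean e)" using i by simp
  show "expectation (\<lambda>\<omega>. (\<Sum>i<n. e (Z i \<omega>)) / real n + mean e) = 2 * mean e"
    using i \<open>n \<ge> 1\<close> by (simp add: expectation_copy prob_space)
qed

text \<open>Truncation of the envelope \<open>\<eta>\<close> at level \<open>B\<close> leaves summands bounded by \<open>c B\<close>, which cost
  \<open>c B \<rho>\<close> in the previous lemma, while the discarded part has mean at most \<open>c A B powr (1 - m)\<close>. The choice
  \<open>B = \<rho> powr (- 1 / m)\<close> balances the two.\<close>

lemma heavy_tailed_maximal_inequality:
  fixes \<phi> :: "'j \<Rightarrow> 'z \<Rightarrow> real"
  assumes J: "finite J" "J \<noteq> {}"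
    and \<phi>_meas [measurable]: "\<And>j. j \<in> J \<Longrightarrow> \<phi> j \<in> borel_measurable T"
    and \<eta>_meas [measurable]: "\<eta> \<in> borel_measurable T"
    and bd: "\<And>j z. j \<in> J \<Longrightarrow> z \<in> space T \<Longrightarrow> \<bar>\<phi> j z\<bar> \<le> c * \<eta> z" and "c > 0"
    and \<eta>: "\<And>z. \<eta> z > 0" "integrable_obs \<eta>" "integrable_obs (\<lambda>z. \<eta> z powr m)" "m > 1"
    and A: "mean (\<lambda>z. \<eta> z powr m) \<le> A"
    and r: "ln (2 * real (card J)) \<le> real n * \<rho>" "\<rho> > 0" and "n \<ge> 1"
    and v: "\<And>j. j \<in> J \<Longrightarrow> mean (\<lambda>z. (if \<eta> z \<le> \<rho> powr (- 1 / m) then \<phi> j z else 0)\<^sup>2) \<le> v"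
      "v > 0"
  shows "\<exists>V. integrable \<Omega> V \<and> (\<forall>j\<in>J. \<forall>\<omega>\<in>space \<Omega>. \<bar>dev n (\<phi> j) \<omega>\<bar> \<le> V \<omega>) \<and>
      expectation V \<le> 2 * (1 + A) * (c * \<rho> powr (1 - 1 / m)) + 2 * sqrt (\<rho> * v)"
proof -
  define B where "B = \<rho> powr (- 1 / m)"
  have B: "B > 0" using r by (simp add: B_def)
  define h where "h j z = (if \<eta> z \<le> B then \<phi> j z else 0)" for j z
  define \<tau> where "\<tau> z = (if \<eta> z \<le> B then 0 else c * \<eta> z)" for z
  have [measurable]: "h j \<in> borel_measurable T" if "j \<in> J" for j
    using that unfolding h_def by measurable
  have [measurable]: "\<tau> \<in> borel_measurable T" unfolding \<tau>_def by measurable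
  have \<eta>B: "\<eta> z \<le> B powr (1 - m) * \<eta> z powr m" if "\<eta> z > B" for z
  proof -
    have "B powr (m - 1) \<le> \<eta> z powr (m - 1)" using that B \<open>m > 1\<close> by (intro powr_mono2) auto
    then have "B powr (1 - m) * B powr (m - 1) * \<eta> z \<le> B powr (1 - m) * \<eta> z powr (m - 1) * \<eta> z"
      using \<eta>(1)[of z] by (intro mult_right_mono mult_left_mono) auto
    moreover have "B powr (1 - m) * B powr (m - 1) = 1" using B by (simp add: powr_add[symmetric])
    moreover have "\<eta> z powr (m - 1) * \<eta> z = \<eta> z powr m"
      using \<eta>(1)[of z] by (simp add: powr_mult_base mult.commute)
    ultimately show ?thesis by (simp add: mult.assoc)
  qed
  have hb: "\<bar>h j z\<bar> \<le> (2 * c * B) / 2" if "j \<in> J" "z \<in> space T" for j z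
  proof (cases "\<eta> z \<le> B")
    case True
    then have "c * \<eta> z \<le> c * B" using \<open>c > 0\<close> by simp
    then show ?thesis using bd[OF that] True by (simp add: h_def)
  qed (use B \<open>c > 0\<close> in \<open>simp add: h_def\<close>)
  have "\<exists>V. integrable \<Omega> V \<and> (\<forall>j\<in>J. \<forall>\<omega>. \<bar>dev n (h j) \<omega>\<bar> \<le> V \<omega>) \<and>
      expectation V \<le> \<rho> * (2 * c * B) + 2 * sqrt (\<rho> * v)"
    by (rule finite_maximal_inequality[OF J _ hb _ _ _ \<open>n \<ge> 1\<close> r])
      (use B \<open>c > 0\<close> v in \<open>auto simp: h_def B_def\<close>)
  then obtain V where V: "integrable \<Omega> V" "\<And>j \<omega>. j \<in> J \<Longrightarrow> \<bar>dev n (h j) \<omega>\<bar> \<le> V \<omega>"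
      "expectation V \<le> \<rho> * (2 * c * B) + 2 * sqrt (\<rho> * v)" by blast
  have \<tau>int: "integrable_obs \<tau>"
  proof (rule integrable_obs_bound)
    show "integrable_obs (\<lambda>z. c * \<eta> z)" using \<eta> by simp
    show "\<bar>\<tau> z\<bar> \<le> c * \<eta> z" for z using \<eta>(1)[of z] \<open>c > 0\<close> by (simp add: \<tau>_def)
  qed simp
  have "mean \<tau> \<le> mean (\<lambda>z. c * B powr (1 - m) * \<eta> z powr m)"
  proof (rule mean_mono[OF \<tau>int])
    show "\<tau> z \<le> c * B powr (1 - m) * \<eta> z powr m" for z
      using mult_left_mono[OF \<eta>B, of z c] \<open>c > 0\<close> by (auto simp: \<tau>_def mult.assoc)
  qed (use \<eta> in simp)
  also have "\<dots> = c * B powr (1 - m) * mean (\<lambda>z. \<eta> z powr m)" by (simp add: mean_def)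
  also have "\<dots> \<le> c * B powr (1 - m) * A" using A \<open>c > 0\<close> by (intro mult_left_mono) auto
  finally have m\<tau>: "mean \<tau> \<le> c * B powr (1 - m) * A" .
  define W where "W \<omega> = (\<Sum>i<n. \<tau> (Z i \<omega>)) / real n + mean \<tau>" for \<omega>
  have W: "integrable \<Omega> W" "expectation W = 2 * mean \<tau>"
    unfolding W_def using empirical_plus_mean[OF _ \<tau>int \<open>n \<ge> 1\<close>] by auto
  have dom: "\<bar>dev n (\<phi> j) \<omega>\<bar> \<le> V \<omega> + W \<omega>" if j: "j \<in> J" and \<omega>: "\<omega> \<in> space \<Omega>" for j \<omega>
  proof -
    have [measurable]: "\<phi> j \<in> borel_measurable T" "h j \<in> borel_measurable T" using j by auto
    have ih: "integrable_obs (h j)" by (rule integrable_bounded_obs[OF _ hb[OF j]]) auto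
    have i\<phi>: "integrable_obs (\<phi> j)"
      by (rule integrable_obs_bound[of _ "\<lambda>z. c * \<eta> z"]) (use \<eta> bd j in auto)
    have ik: "integrable_obs (\<lambda>z. \<phi> j z - h j z)" using ih i\<phi> by simp
    have "dev n (\<phi> j) \<omega> = dev n (h j) \<omega> + dev n (\<lambda>z. \<phi> j z - h j z) \<omega>"
      using dev_add[OF ih ik, of n \<omega>] by simp
    moreover have "\<bar>dev n (\<lambda>z. \<phi> j z - h j z) \<omega>\<bar> \<le> W \<omega>" unfolding W_def
      by (rule dev_dominated[OF _ \<tau>int ik _ \<omega>]) (use bd j in \<open>auto simp: h_def \<tau>_def\<close>)
    ultimately show ?thesis using V(2)[OF j, of \<omega>] by linarith
  qed
  have p1: "B powr (1 - m) = \<rho> powr (1 - 1 / m)"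
  proof -
    have "(- 1 / m) * (1 - m) = 1 - 1 / m" using \<open>m > 1\<close> by (simp add: field_simps)
    then show ?thesis by (simp add: B_def powr_powr del: minus_divide_left)
  qed
  have p2: "\<rho> * B = \<rho> powr (1 - 1 / m)"
    using r(2) by (simp add: B_def powr_mult_base)
  have "expectation (\<lambda>\<omega>. V \<omega> + W \<omega>) = expectation V + 2 * mean \<tau>"
    using V W by simp
  also have "\<dots> \<le> (\<rho> * (2 * c * B) + 2 * sqrt (\<rho> * v)) + 2 * (c * B powr (1 - m) * A)"
    using V(3) m\<tau> by linarith
  also have "\<dots> = 2 * (1 + A) * (c * \<rho> powr (1 - 1 / m)) + 2 * sqrt (\<rho> * v)"
    unfolding p1 p2[symmetric] by (simp add: algebra_simps)
  finally show ?thesis using V(1) W(1) dom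
    by (intro exI[of _ "\<lambda>\<omega>. V \<omega> + W \<omega>"]) auto
qed

text \<open>The telescoping sum over the links \<open>\<pi> (Suc k) f - \<pi> k f\<close>. Only the pairs of net points that occur as a link
  are counted, at most \<open>card (N (Suc k)) * card (N k)\<close> at level \<open>k\<close>.\<close>

lemma chaining:
  fixes \<phi> :: "'f \<Rightarrow> 'z \<Rightarrow> real" and N :: "nat \<Rightarrow> 'f set"
  assumes "G \<noteq> {}" and "n \<ge> 1"
    and \<phi>_meas [measurable]: "\<And>f. f \<in> G \<Longrightarrow> \<phi> f \<in> borel_measurable T"
    and \<phi>_int: "\<And>f. f \<in> G \<Longrightarrow> integrable_obs (\<phi> f)"
    and \<eta>_meas [measurable]: "\<eta> \<in> borel_measurable T"
    and \<eta>: "\<And>z. \<eta> z > 0" "integrable_obs \<eta>" "integrable_obs (\<lambda>z. \<eta> z powr m)" "m > 1"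
    and A: "mean (\<lambda>z. \<eta> z powr m) \<le> A"
    and N: "\<And>k. k \<le> K \<Longrightarrow> finite (N k)" "\<And>k. k \<le> K \<Longrightarrow> N k \<subseteq> G"
    and \<pi>: "\<And>f k. f \<in> G \<Longrightarrow> k \<le> K \<Longrightarrow> \<pi> k f \<in> N k"
    and zero: "\<And>f z. f \<in> G \<Longrightarrow> \<phi> (\<pi> 0 f) z = 0"
    and link: "\<And>f k z. f \<in> G \<Longrightarrow> k < K \<Longrightarrow> z \<in> space T \<Longrightarrow>
        \<bar>\<phi> (\<pi> (Suc k) f) z - \<phi> (\<pi> k f) z\<bar> \<le> c k * \<eta> z" and c: "\<And>k. k < K \<Longrightarrow> c k > 0"
    and rest: "\<And>f z. f \<in> G \<Longrightarrow> z \<in> space T \<Longrightarrow> \<bar>\<phi> f z - \<phi> (\<pi> K f) z\<bar> \<le> c' * \<eta> z"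
    and r: "\<And>k. k < K \<Longrightarrow> ln (2 * (real (card (N (Suc k))) * real (card (N k)))) \<le> real n * \<rho> k"
      "\<And>k. k < K \<Longrightarrow> \<rho> k > 0"
    and v: "\<And>f k. f \<in> G \<Longrightarrow> k < K \<Longrightarrow> mean (\<lambda>z. (if \<eta> z \<le> \<rho> k powr (- 1 / m)
        then \<phi> (\<pi> (Suc k) f) z - \<phi> (\<pi> k f) z else 0)\<^sup>2) \<le> v k" "\<And>k. k < K \<Longrightarrow> v k > 0"
  shows "\<exists>V. integrable \<Omega> V \<and> (\<forall>f\<in>G. \<forall>\<omega>\<in>space \<Omega>. \<bar>dev n (\<phi> f) \<omega>\<bar> \<le> V \<omega>) \<and>
      expectation V \<le> (\<Sum>k<K. 2 * (1 + A) * (c k * \<rho> k powr (1 - 1 / m)) + 2 * sqrt (\<rho> k * v k))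
        + 2 * c' * mean \<eta>"
proof -
  define \<psi> where "\<psi> p z = \<phi> (fst p) z - \<phi> (snd p) z" for p :: "'f \<times> 'f" and z
  have \<pi>G: "\<pi> k f \<in> G" if "f \<in> G" "k \<le> K" for k f using \<pi> N that by blast
  have "\<exists>V. integrable \<Omega> V \<and> (\<forall>f\<in>G. \<forall>\<omega>\<in>space \<Omega>. \<bar>dev n (\<psi> (\<pi> (Suc k) f, \<pi> k f)) \<omega>\<bar> \<le> V \<omega>) \<and>
      expectation V \<le> 2 * (1 + A) * (c k * \<rho> k powr (1 - 1 / m)) + 2 * sqrt (\<rho> k * v k)"
    if k: "k < K" for k
  proof -
    define J where "J = (\<lambda>f. (\<pi> (Suc k) f, \<pi> k f)) ` G"
    have sub: "J \<subseteq> N (Suc k) \<times> N k" unfolding J_def using \<pi> k by auto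
    have fin: "finite (N (Suc k) \<times> N k)" using N k by auto
    have J: "finite J" "J \<noteq> {}" using finite_subset[OF sub fin] \<open>G \<noteq> {}\<close> by (auto simp: J_def)
    have "card J \<le> card (N (Suc k)) * card (N k)"
      using card_mono[OF fin sub] by (simp add: card_cartesian_product)
    then have "real (card J) \<le> real (card (N (Suc k))) * real (card (N k))"
      by (metis of_nat_le_iff of_nat_mult)
    then have "ln (2 * real (card J)) \<le> ln (2 * (real (card (N (Suc k))) * real (card (N k))))"
      using J by (intro ln_mono) (auto simp: card_gt_0_iff)
    then have rJ: "ln (2 * real (card J)) \<le> real n * \<rho> k" using r(1)[OF k] by simp
    have "\<exists>V. integrable \<Omega> V \<and> (\<forall>j\<in>J. \<forall>\<omega>\<in>space \<Omega>. \<bar>dev n (\<psi> j) \<omega>\<bar> \<le> V \<omega>) \<and>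
      expectation V \<le> 2 * (1 + A) * (c k * \<rho> k powr (1 - 1 / m)) + 2 * sqrt (\<rho> k * v k)"
    proof (rule heavy_tailed_maximal_inequality[OF J _ \<eta>_meas _ c[OF k] \<eta> A rJ r(2)[OF k] \<open>n \<ge> 1\<close> _ v(2)[OF k]])
      show "\<psi> j \<in> borel_measurable T" if "j \<in> J" for j
      proof -
        have [measurable]: "\<phi> (fst j) \<in> borel_measurable T" "\<phi> (snd j) \<in> borel_measurable T"
          using that \<pi>G k by (auto simp: J_def)
        show ?thesis unfolding \<psi>_def by measurable
      qed
      show "\<bar>\<psi> j z\<bar> \<le> c k * \<eta> z" if "j \<in> J" "z \<in> space T" for j z
        using that link k by (auto simp: J_def \<psi>_def)
      show "mean (\<lambda>z. (if \<eta> z \<le> \<rho> k powr (- 1 / m) then \<psi> j z else 0)\<^sup>2) \<le> v k" if "j \<in> J" for j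
      proof -
        obtain f where f: "f \<in> G" "j = (\<pi> (Suc k) f, \<pi> k f)" using \<open>j \<in> J\<close> by (auto simp: J_def)
        show ?thesis using v(1)[OF f(1) k] unfolding f(2) \<psi>_def fst_conv snd_conv .
      qed
    qed
    then show ?thesis by (simp add: J_def)
  qed
  then obtain V where V: "\<And>k. k < K \<Longrightarrow> integrable \<Omega> (V k)"
    "\<And>k f \<omega>. k < K \<Longrightarrow> f \<in> G \<Longrightarrow> \<omega> \<in> space \<Omega> \<Longrightarrow> \<bar>dev n (\<psi> (\<pi> (Suc k) f, \<pi> k f)) \<omega>\<bar> \<le> V k \<omega>"
    "\<And>k. k < K \<Longrightarrow> expectation (V k)
      \<le> 2 * (1 + A) * (c k * \<rho> k powr (1 - 1 / m)) + 2 * sqrt (\<rho> k * v k)"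
    by metis
  define W where "W \<omega> = (\<Sum>i<n. c' * \<eta> (Z i \<omega>)) / real n + mean (\<lambda>z. c' * \<eta> z)" for \<omega>
  have i\<eta>: "integrable_obs (\<lambda>z. c' * \<eta> z)" using \<eta> by simp
  have W: "integrable \<Omega> W" "expectation W = 2 * c' * mean \<eta>"
    unfolding W_def using empirical_plus_mean[OF _ i\<eta> \<open>n \<ge> 1\<close>] by (auto simp: mean_def)
  have dom: "\<bar>dev n (\<phi> f) \<omega>\<bar> \<le> (\<Sum>k<K. V k \<omega>) + W \<omega>" if f: "f \<in> G" and \<omega>: "\<omega> \<in> space \<Omega>" for f \<omega>
  proof -
    let ?l = "\<lambda>k. \<psi> (\<pi> (Suc k) f, \<pi> k f)"
    have il: "integrable_obs (?l k)" if "k < K" for k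
      unfolding \<psi>_def using \<pi>G[OF f] \<phi>_int that by auto
    have isum: "integrable_obs (\<lambda>z. \<Sum>k<K. ?l k z)"
      using il by (intro Bochner_Integration.integrable_sum) auto
    have ir: "integrable_obs (\<lambda>z. \<phi> f z - \<phi> (\<pi> K f) z)" using \<pi>G[OF f] \<phi>_int f by auto
    have "\<phi> f = (\<lambda>z. (\<phi> f z - \<phi> (\<pi> K f) z) + (\<Sum>k<K. ?l k z))"
      using zero[OF f] by (auto simp: \<psi>_def sum_lessThan_telescope[of "\<lambda>k. \<phi> (\<pi> k f) _"])
    then have "dev n (\<phi> f) \<omega> = dev n (\<lambda>z. \<phi> f z - \<phi> (\<pi> K f) z) \<omega> + (\<Sum>k<K. dev n (?l k) \<omega>)"
      using dev_add[OF ir isum, of n \<omega>] dev_sum[of "{..<K}" ?l n \<omega>, OF il] by simp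
    moreover have "\<bar>dev n (\<lambda>z. \<phi> f z - \<phi> (\<pi> K f) z) \<omega>\<bar> \<le> W \<omega>" unfolding W_def
      by (rule dev_dominated[OF _ i\<eta> ir rest[OF f] \<omega>]) auto
    moreover have "\<bar>\<Sum>k<K. dev n (?l k) \<omega>\<bar> \<le> (\<Sum>k<K. V k \<omega>)"
      by (rule order_trans[OF sum_abs]) (use V(2) f \<omega> in \<open>auto intro!: sum_mono\<close>)
    ultimately show ?thesis by linarith
  qed
  have iV: "integrable \<Omega> (\<lambda>\<omega>. \<Sum>k<K. V k \<omega>)" using V(1) by (intro Bochner_Integration.integrable_sum) auto
  have "expectation (\<lambda>\<omega>. (\<Sum>k<K. V k \<omega>) + W \<omega>) = (\<Sum>k<K. expectation (V k)) + 2 * c' * mean \<eta>"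
    using iV W V(1) by (simp add: Bochner_Integration.integral_sum)
  also have "\<dots> \<le> (\<Sum>k<K. 2 * (1 + A) * (c k * \<rho> k powr (1 - 1 / m)) + 2 * sqrt (\<rho> k * v k))
        + 2 * c' * mean \<eta>"
    using V(3) by (intro add_right_mono sum_mono) auto
  finally show ?thesis using iV W(1) dom
    by (intro exI[of _ "\<lambda>\<omega>. (\<Sum>k<K. V k \<omega>) + W \<omega>"]) auto
qed

end

section \<open>Entropy, envelope and dyadic scales\<close>

lemma log_plus_ge: "log_plus x \<ge> 1" "log_plus x \<ge> ln x" "log_plus x > 0"
  by (auto simp: log_plus_def)

text \<open>A dyadic decomposition of a range whose end points have a ratio polynomial in \<open>n\<close> has \<open>O(log n)\<close> levels; this
  is used for the chaining levels and for the shells of the peeling.\<close>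

lemma dyadic_count:
  fixes c x :: real
  assumes "2 ^ k \<le> c * x" "c \<ge> 1" "x > 0"
  shows "real k \<le> (2 + 2 * ln c) * log_plus x"
proof -
  have "real k * (1 / 2) \<le> real k * ln 2" 
    using ln2_ge_two_thirds by (intro mult_left_mono) auto
  also have "\<dots> = ln (2 ^ k)" by (simp add: ln_realpow)
  also have "\<dots> \<le> ln (c * x)" using assms by (subst ln_le_cancel_iff) auto
  also have "\<dots> = ln c + ln x" using assms by (simp add: ln_mult)
  also have "\<dots> \<le> ln c * log_plus x + log_plus x"
    using assms log_plus_ge[of x] mult_left_mono[of 1 "log_plus x" "ln c"] by (intro add_mono) auto
  finally show ?thesis by (simp add: algebra_simps)
qed

lemma log_plus_quotient:
  fixes U x n :: real
  assumes "U \<ge> 1" "n \<ge> 1" "1 / (2 * n) \<le> x"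
  shows "log_plus (U / x) \<le> (1 + ln (2 * U)) * log_plus n"
proof -
  have x: "x > 0" by (rule less_le_trans[of 0 "1 / (2 * n)"]) (use assms in auto)
  have "U / x \<le> U * (2 * n)" using assms x by (simp add: field_simps)
  then have "ln (U / x) \<le> ln (2 * U * n)" using assms x by (subst ln_le_cancel_iff) (auto simp: ac_simps)
  also have "\<dots> = ln (2 * U) + ln n" using assms by (subst ln_mult) auto
  also have "\<dots> \<le> ln (2 * U) * log_plus n + log_plus n"
    using assms log_plus_ge[of n] mult_left_mono[of 1 "log_plus n" "ln (2 * U)"] by (intro add_mono) auto
  finally have 1: "ln (U / x) \<le> (1 + ln (2 * U)) * log_plus n" by (simp add: algebra_simps)
  have "1 * 1 \<le> (1 + ln (2 * U)) * log_plus n"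
    using assms log_plus_ge[of n] by (intro mult_mono) auto
  with 1 show ?thesis by (simp add: log_plus_def)
qed

lemma unif_dist_le_iff: "unif_dist A f g \<le> ereal h \<longleftrightarrow> (\<forall>z\<in>A. \<bar>f z - g z\<bar> \<le> h)"
  by (simp add: unif_dist_def unif_norm_def SUP_le_iff)

text \<open>Nets of a subclass \<open>G\<close> have to lie in \<open>G\<close>, so that links between net points inherit the \<open>L\<^sup>2\<close>
  radius of \<open>G\<close>. Replacing every centre that is close to \<open>G\<close> by a point of \<open>G\<close> doubles the radius.\<close>

lemma internal_net:
  assumes ent: "entropy_condition A \<gamma> C0 U a0 F D" and "x > 0" and G: "G \<subseteq> F" "G \<noteq> {}"
  shows "\<exists>N\<subseteq>G. finite N \<and> N \<noteq> {} \<and>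
      ln (real (card N)) \<le> C0 * D * x powr (- \<gamma>) * log_plus (U / x) powr a0 \<and>
      (\<forall>f\<in>G. \<exists>g\<in>N. \<forall>z\<in>A. \<bar>f z - g z\<bar> \<le> 2 * x)"
proof -
  define H where "H = C0 * D * x powr (- \<gamma>) * log_plus (U / x) powr a0"
  define covers where "covers = {C. C \<subseteq> F \<and> (\<forall>k\<in>F. \<exists>c\<in>C. unif_dist A k c \<le> ereal x)}"
  define sz where "sz C = (if finite C then enat (card C) else \<infinity>)" for C :: "('a \<Rightarrow> real) set"
  have ce: "covering_entropy x F (unif_dist A) \<le> ereal H"
    using ent \<open>x > 0\<close> by (simp add: entropy_condition_def H_def)
  have cn: "covering_number x F (unif_dist A) = Inf (sz ` covers)"
    unfolding covering_number_def covers_def sz_def by simp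
  obtain k where k: "Inf (sz ` covers) = enat k" "ln (real k) \<le> H"
    using ce unfolding covering_entropy_def cn by (cases "Inf (sz ` covers)") auto
  then have ne: "sz ` covers \<noteq> {}" by (metis Inf_empty enat.distinct(1) top_enat_def)
  then have "Inf (sz ` covers) \<in> sz ` covers" by (auto simp: Inf_enat_def intro: LeastI)
  then obtain C where C: "C \<in> covers" "finite C" "card C = k"
    using k(1) by (auto simp: sz_def split: if_splits)
  define C' where "C' = {c\<in>C. \<exists>g\<in>G. \<forall>z\<in>A. \<bar>g z - c z\<bar> \<le> x}"
  have "\<forall>c\<in>C'. \<exists>g\<in>G. \<forall>z\<in>A. \<bar>g z - c z\<bar> \<le> x" by (auto simp: C'_def)
  then obtain r where r: "\<And>c. c \<in> C' \<Longrightarrow> r c \<in> G"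
    "\<And>c z. c \<in> C' \<Longrightarrow> z \<in> A \<Longrightarrow> \<bar>r c z - c z\<bar> \<le> x" by metis
  have fin: "finite C'" using C by (simp add: C'_def)
  have near: "\<exists>g\<in>r ` C'. \<forall>z\<in>A. \<bar>f z - g z\<bar> \<le> 2 * x" if f: "f \<in> G" for f
  proof -
    obtain c where c: "c \<in> C" "\<And>z. z \<in> A \<Longrightarrow> \<bar>f z - c z\<bar> \<le> x"
      using C(1) f G by (auto simp: covers_def unif_dist_le_iff) blast
    then have c': "c \<in> C'" using f by (auto simp: C'_def)
    have "\<bar>f z - r c z\<bar> \<le> 2 * x" if "z \<in> A" for z
      using c(2)[OF that] r(2)[OF c' that] by linarith
    then show ?thesis using c' by blast
  qed
  have ne': "r ` C' \<noteq> {}" using near G by blast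
  have "card (r ` C') \<le> k"
    using card_image_le[OF fin, of r] card_mono[OF C(2), of C'] C(3) by (simp add: C'_def)
  moreover have "card (r ` C') > 0" using ne' fin by (simp add: card_gt_0_iff)
  ultimately have "ln (real (card (r ` C'))) \<le> ln (real k)" by (intro ln_mono) auto
  with k(2) have "ln (real (card (r ` C'))) \<le> H" by simp
  then show ?thesis using near ne' fin r(1) unfolding H_def
    by (intro exI[of _ "r ` C'"]) auto
qed

text \<open>The envelope condition applied to the singleton of \<open>f - fs\<close> already confines an \<open>L\<^sup>2\<close> ball around
  \<open>fs\<close> to a uniform ball.\<close>

lemma L2_radius_imp_uniform:
  assumes env: "envelope_condition P s C1 F" and "fs \<in> F" and "0 \<le> s"
    and "t > 0" and "f \<in> F" and f: "L2_norm P (\<lambda>x. f x - fs x) \<le> t" and "x \<in> space P"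
  shows "\<bar>f x - fs x\<bar> \<le> max C1 0 * t powr s"
proof -
  let ?g = "\<lambda>x. f x - fs x"
  have "unif_norm (space P) (envelope {?g}) \<le> ereal (C1 * rpow (SUP g\<in>{?g}. L2_norm P g) s)"
    using env \<open>fs \<in> F\<close> \<open>f \<in> F\<close> unfolding envelope_condition_def by blast
  then have "\<bar>?g x\<bar> \<le> C1 * rpow (L2_norm P ?g) s"
    using \<open>x \<in> space P\<close> by (auto simp: unif_norm_def envelope_def SUP_le_iff)
  also have "\<dots> \<le> max C1 0 * rpow (L2_norm P ?g) s"
    by (intro mult_right_mono) (auto simp: rpow_def)
  also have "rpow (L2_norm P ?g) s \<le> t powr s"
    using f \<open>t > 0\<close> \<open>0 \<le> s\<close> by (auto simp: rpow_def L2_norm_def intro!: powr_mono2)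
  then have "max C1 0 * rpow (L2_norm P ?g) s \<le> max C1 0 * t powr s"
    by (intro mult_left_mono) auto
  finally show ?thesis .
qed

lemma powr_le_endpoints:
  fixes x :: real
  assumes "0 < a" "a \<le> x" "x \<le> b"
  shows "x powr p \<le> a powr p + b powr p"
proof (cases "p \<ge> 0")
  case True
  then have "x powr p \<le> b powr p" using assms by (intro powr_mono2) auto
  then show ?thesis by (simp add: add_increasing)
next
  case False
  then have "x powr p \<le> a powr p" using assms by (intro powr_mono2') auto
  then show ?thesis by (simp add: add_increasing2)
qed

text \<open>With entropy \<open>D x powr (-\<gamma>)\<close> and \<open>N = n / D\<close>, the left-hand side is the truncation term of a link at scale
  \<open>x\<close>. It is a power of \<open>x\<close>, hence largest at an end point of the range of scales. At the lower end
  \<open>t \<delta> / 2\<close> the entropy per observation is bounded by \<open>d1\<close>; at the upper end \<open>c t powr s\<close> the claim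
  reduces to \<open>d2\<close>, because powers of \<open>t\<close> with exponent at most \<open>0\<close> are largest at \<open>t = \<delta>\<close>. For \<open>q = 1/2\<close>, \<open>s = 1\<close> and \<open>c = 1\<close> the same statement serves for the variance
  term.\<close>

lemma scale_bound:
  fixes N :: real
  assumes "N > 0" "\<delta> > 0" "\<delta> \<le> t" "0 < q" "q \<le> 1" "\<gamma> \<ge> 0" "0 \<le> s" "s \<le> 1" "c \<ge> 1"
    and d1: "1 / N \<le> \<delta> powr (2 * \<gamma>)"
    and d2: "1 / N \<le> \<delta> powr ((2 - s) / q + s * \<gamma>)"
    and x: "t * \<delta> / 2 \<le> x" "x \<le> c * t powr s"
  shows "x * (x powr (- \<gamma>) / N) powr q \<le> (2 powr \<gamma> + c) * (t * \<delta>)"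
proof -
  define \<Phi> where "\<Phi> y = y * (y powr (- \<gamma>) / N) powr q" for y :: real
  have t: "t > 0" using assms by simp
  have a0: "t * \<delta> / 2 > 0" using t \<open>\<delta> > 0\<close> by simp
  have \<Phi>: "\<Phi> y = y powr (1 - \<gamma> * q) * N powr (- q)" if "y > 0" for y
    using that \<open>N > 0\<close>
    by (simp add: \<Phi>_def powr_divide powr_powr powr_diff powr_minus powr_mult field_simps)
  have "\<Phi> x \<le> ((t * \<delta> / 2) powr (1 - \<gamma> * q) + (c * t powr s) powr (1 - \<gamma> * q)) * N powr (- q)"
    using a0 x by (subst \<Phi>) (auto intro!: mult_right_mono powr_le_endpoints)
  also have "\<dots> = \<Phi> (t * \<delta> / 2) + \<Phi> (c * t powr s)"
    using a0 t \<open>c \<ge> 1\<close> by (simp add: \<Phi> algebra_simps)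
  finally have split: "\<Phi> x \<le> \<Phi> (t * \<delta> / 2) + \<Phi> (c * t powr s)" .
  have lower: "\<Phi> (t * \<delta> / 2) \<le> 2 powr \<gamma> * (t * \<delta>)"
  proof -
    have "(t * \<delta> / 2) powr (- \<gamma>) \<le> (\<delta> * \<delta> / 2) powr (- \<gamma>)"
      using assms t by (intro powr_mono2') auto
    also have "\<dots> = 2 powr \<gamma> * \<delta> powr (- (2 * \<gamma>))"
      using \<open>\<delta> > 0\<close> by (simp add: powr_divide powr_mult powr_minus powr_add[symmetric] field_simps mult_2)
    finally have "(t * \<delta> / 2) powr (- \<gamma>) / N \<le> 2 powr \<gamma> * \<delta> powr (- (2 * \<gamma>)) * (1 / N)"
      using \<open>N > 0\<close> by (simp add: divide_right_mono)
    also have "\<dots> \<le> 2 powr \<gamma> * \<delta> powr (- (2 * \<gamma>)) * \<delta> powr (2 * \<gamma>)"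
      using d1 by (intro mult_left_mono) auto
    also have "\<dots> = 2 powr \<gamma>" using \<open>\<delta> > 0\<close> by (simp add: powr_minus)
    finally have "((t * \<delta> / 2) powr (- \<gamma>) / N) powr q \<le> (2 powr \<gamma>) powr q"
      using \<open>N > 0\<close> \<open>q > 0\<close> by (intro powr_mono2) auto
    also have "\<dots> \<le> (2 powr \<gamma>) powr 1"
      using \<open>q \<le> 1\<close> \<open>\<gamma> \<ge> 0\<close> by (intro powr_mono ge_one_powr_ge_zero) auto
    finally have le: "((t * \<delta> / 2) powr (- \<gamma>) / N) powr q \<le> 2 powr \<gamma>" by simp
    have "\<Phi> (t * \<delta> / 2) \<le> (t * \<delta>) * 2 powr \<gamma>" unfolding \<Phi>_def
      by (rule mult_mono) (use le t \<open>\<delta> > 0\<close> in auto)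
    then show ?thesis by (simp add: mult.commute)
  qed
  have upper: "\<Phi> (c * t powr s) \<le> c * (t * \<delta>)"
  proof -
    have "(c * t powr s) powr (- \<gamma>) \<le> (\<delta> powr s) powr (- \<gamma>)"
    proof (rule powr_mono2')
      have "\<delta> powr s \<le> t powr s" using assms by (intro powr_mono2) auto
      then show "\<delta> powr s \<le> c * t powr s"
        using \<open>c \<ge> 1\<close> mult_right_mono[of 1 c "t powr s"] by simp
    qed (use assms in auto)
    then have "(c * t powr s) powr (- \<gamma>) / N \<le> \<delta> powr (- (s * \<gamma>)) * (1 / N)"
      using \<open>N > 0\<close> by (simp add: powr_powr divide_right_mono)
    also have "\<dots> \<le> \<delta> powr (- (s * \<gamma>)) * \<delta> powr ((2 - s) / q + s * \<gamma>)"
      using d2 by (intro mult_left_mono) auto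
    also have "\<dots> = \<delta> powr ((2 - s) / q)" by (simp add: powr_add[symmetric])
    finally have "((c * t powr s) powr (- \<gamma>) / N) powr q \<le> (\<delta> powr ((2 - s) / q)) powr q"
      using \<open>N > 0\<close> \<open>q > 0\<close> by (intro powr_mono2) auto
    also have "\<dots> = \<delta> powr (2 - s)" using \<open>q > 0\<close> by (simp add: powr_powr)
    finally have le: "((c * t powr s) powr (- \<gamma>) / N) powr q \<le> \<delta> powr (2 - s)" .
    have "t powr s = t * t powr (s - 1)" using t by (simp add: powr_mult_base)
    also have "\<dots> \<le> t * \<delta> powr (s - 1)"
      using assms t by (intro mult_left_mono powr_mono2') auto
    finally have "c * t powr s \<le> c * (t * \<delta> powr (s - 1))" using \<open>c \<ge> 1\<close> by simp
    then have "\<Phi> (c * t powr s) \<le> (c * (t * \<delta> powr (s - 1))) * \<delta> powr (2 - s)"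
      unfolding \<Phi>_def by (rule mult_mono) (use le \<open>c \<ge> 1\<close> t in auto)
    also have "\<dots> = c * (t * \<delta>)"
      using \<open>\<delta> > 0\<close> by (simp add: mult.assoc powr_add[symmetric])
    finally show ?thesis .
  qed
  have "(2 powr \<gamma> + c) * (t * \<delta>) = 2 powr \<gamma> * (t * \<delta>) + c * (t * \<delta>)"
    by (rule distrib_right)
  then show ?thesis using split lower upper by (simp add: \<Phi>_def)
qed

text \<open>Above the scale \<open>t\<close> the variance of a link no longer grows, and \<open>x = t\<close> is the worst case; below it,
  \<open>scale_bound\<close> applies, where \<open>d2\<close> is its condition for square roots.\<close>

lemma variance_scale_bound:
  fixes N :: real
  assumes "N > 0" "\<delta> > 0" "\<delta> \<le> t" "\<delta> \<le> 2" "\<gamma> \<ge> 0"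
    and d1: "1 / N \<le> \<delta> powr (2 * \<gamma>)" and d2: "1 / N \<le> \<delta> powr (2 + \<gamma>)"
    and x: "t * \<delta> / 2 \<le> x"
  shows "min t x * sqrt (x powr (- \<gamma>) / N) \<le> (2 powr \<gamma> + 1) * (t * \<delta>)"
proof -
  have t: "t > 0" using assms by simp
  have *: "y * sqrt (y powr (- \<gamma>) / N) \<le> (2 powr \<gamma> + 1) * (t * \<delta>)" if "t * \<delta> / 2 \<le> y" "y \<le> t" for y
  proof -
    have "y * (y powr (- \<gamma>) / N) powr (1 / 2) \<le> (2 powr \<gamma> + 1) * (t * \<delta>)"
      by (rule scale_bound[where s=1]) (use assms that t in auto)
    then show ?thesis using \<open>N > 0\<close> by (simp add: powr_half_sqrt)
  qed
  show ?thesis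
  proof (cases "x \<le> t")
    case True
    then have "min t x = x" by simp
    then show ?thesis using *[OF x True] by simp
  next
    case False
    have "x powr (- \<gamma>) \<le> t powr (- \<gamma>)" using False t assms by (intro powr_mono2') auto
    then have "sqrt (x powr (- \<gamma>) / N) \<le> sqrt (t powr (- \<gamma>) / N)"
      using \<open>N > 0\<close> by (simp add: divide_right_mono)
    then have "min t x * sqrt (x powr (- \<gamma>) / N) \<le> t * sqrt (t powr (- \<gamma>) / N)"
      using False t by simp
    also have "\<dots> \<le> (2 powr \<gamma> + 1) * (t * \<delta>)"
      by (rule *) (use t \<open>\<delta> \<le> 2\<close> in auto)
    finally show ?thesis .
  qed
qed

definition heavy_tail_exponent :: "real \<Rightarrow> real \<Rightarrow> real \<Rightarrow> real" where
  "heavy_tail_exponent m s \<gamma> = 1 / ((2 - s) / (1 - 1 / m) + s * \<gamma>)"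

text \<open>The radius \<open>\<delta>\<close> exceeds each of the two rates, which turns the exponents of the rates into the conditions of
  \<open>scale_bound\<close> and \<open>variance_scale_bound\<close>.\<close>

lemma critical_radius:
  fixes n D :: real
  assumes "1 \<le> D" "D \<le> n" "\<gamma> \<ge> 0" "0 \<le> s" "s \<le> 1" "m > 1"
  defines "\<delta> \<equiv> (n / D) powr (- entropy_exponent \<gamma>) + (n / D) powr (- heavy_tail_exponent m s \<gamma>)"
  shows "0 < \<delta>" "\<delta> \<le> 2" "1 / n \<le> \<delta>\<^sup>2" "1 / (n / D) \<le> \<delta> powr (2 * \<gamma>)"
    "1 / (n / D) \<le> \<delta> powr (2 + \<gamma>)"
    "1 / (n / D) \<le> \<delta> powr ((2 - s) / (1 - 1 / m) + s * \<gamma>)"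
proof -
  define N where "N = n / D"
  have N: "N \<ge> 1" "N \<le> n" using assms by (auto simp: N_def field_simps mult_left_mono)
  define e where "e = entropy_exponent \<gamma>"
  define h where "h = heavy_tail_exponent m s \<gamma>"
  have \<delta>: "\<delta> = N powr (- e) + N powr (- h)" by (simp add: \<delta>_def N_def e_def h_def)
  have e: "0 \<le> e" "e \<le> 1 / (2 + \<gamma>)" "e * (2 * \<gamma>) \<le> 1" "e \<le> 1 / 2"
  proof -
    show "0 \<le> e" "e \<le> 1 / (2 + \<gamma>)" using \<open>\<gamma> \<ge> 0\<close> by (auto simp: e_def entropy_exponent_def)
    then show "e \<le> 1 / 2" using \<open>\<gamma> \<ge> 0\<close> by (elim order_trans) (auto simp: field_simps)
    show "e * (2 * \<gamma>) \<le> 1"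
    proof (cases "\<gamma> = 0")
      case False
      then have "e \<le> 1 / (2 * \<gamma>)" by (simp add: e_def entropy_exponent_def)
      then show ?thesis using False \<open>\<gamma> \<ge> 0\<close> by (simp add: field_simps)
    qed simp
  qed
  have den: "(2 - s) / (1 - 1 / m) + s * \<gamma> > 0"
    using assms by (intro add_pos_nonneg divide_pos_pos) auto
  have h: "0 \<le> h" "h * ((2 - s) / (1 - 1 / m) + s * \<gamma>) = 1"
    using den unfolding h_def heavy_tail_exponent_def by (simp_all add: less_imp_neq[OF den, symmetric])
  have pe: "N powr (- e) \<le> \<delta>" "N powr (- h) \<le> \<delta>" "N powr (- e) > 0"
    using N by (auto simp: \<delta>)
  show pos: "0 < \<delta>" using pe by linarith
  have "N powr (- e) \<le> N powr 0" "N powr (- h) \<le> N powr 0"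
    using N e h by (auto intro!: powr_mono simp del: powr_zero_eq_one)
  then show "\<delta> \<le> 2" using N by (simp add: \<delta>)
  have key: "1 / N \<le> \<delta> powr p" if "N powr (- r) \<le> \<delta>" "r * p \<le> 1" "p \<ge> 0" for p r
  proof -
    have "1 / N = N powr (- 1)" using N by (simp add: powr_minus_divide)
    also have "\<dots> \<le> N powr (- r * p)" using N that by (intro powr_mono) auto
    also have "\<dots> = (N powr (- r)) powr p" by (simp add: powr_powr)
    also have "\<dots> \<le> \<delta> powr p" using that by (intro powr_mono2) auto
    finally show ?thesis .
  qed
  have "1 / n \<le> 1 / N" using N by (simp add: field_simps)
  also have "\<dots> \<le> \<delta> powr 2" using pe e by (intro key[of e]) auto
  finally show "1 / n \<le> \<delta>\<^sup>2" using pos by (simp add: powr_numeral)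
  show "1 / (n / D) \<le> \<delta> powr (2 * \<gamma>)"
    using pe e \<open>\<gamma> \<ge> 0\<close> unfolding N_def[symmetric] by (intro key[of e]) auto
  have "e * (2 + \<gamma>) \<le> 1" using e(2) \<open>\<gamma> \<ge> 0\<close> by (simp add: field_simps)
  then show "1 / (n / D) \<le> \<delta> powr (2 + \<gamma>)"
    using pe \<open>\<gamma> \<ge> 0\<close> unfolding N_def[symmetric] by (intro key[of e]) auto
  show "1 / (n / D) \<le> \<delta> powr ((2 - s) / (1 - 1 / m) + s * \<gamma>)"
    using pe h den unfolding N_def[symmetric] by (intro key[of h]) auto
qed

section \<open>The excess loss in heavy-tailed regression\<close>

lemma (in prob_space) integrable_lower_power:
  fixes u :: "'a \<Rightarrow> real"
  assumes [measurable]: "u \<in> borel_measurable M" and "0 \<le> p" "p \<le> m"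
    and "integrable M (\<lambda>\<omega>. \<bar>u \<omega>\<bar> powr m)"
  shows "integrable M (\<lambda>\<omega>. \<bar>u \<omega>\<bar> powr p)"
proof (rule Bochner_Integration.integrable_bound)
  show "integrable M (\<lambda>\<omega>. 1 + \<bar>u \<omega>\<bar> powr m)" 
    by (intro Bochner_Integration.integrable_add integrable_const assms(4))
  show "AE \<omega> in M. norm (\<bar>u \<omega>\<bar> powr p) \<le> norm (1 + \<bar>u \<omega>\<bar> powr m)"
  proof (rule AE_I2)
    fix \<omega>
    have "\<bar>u \<omega>\<bar> powr p \<le> 1 + \<bar>u \<omega>\<bar> powr m"
    proof (cases "\<bar>u \<omega>\<bar> \<le> 1")
      case True
      then have "\<bar>u \<omega>\<bar> powr p \<le> 1" using \<open>0 \<le> p\<close> by (intro powr_le1) auto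
      moreover have "0 \<le> \<bar>u \<omega>\<bar> powr m" by (rule powr_ge_zero)
      ultimately show ?thesis by linarith
    next
      case False
      then have "\<bar>u \<omega>\<bar> powr p \<le> \<bar>u \<omega>\<bar> powr m" using \<open>p \<le> m\<close> by (intro powr_mono) auto
      then show ?thesis by simp
    qed
    then show "norm (\<bar>u \<omega>\<bar> powr p) \<le> norm (1 + \<bar>u \<omega>\<bar> powr m)"
      using powr_ge_zero[of "\<bar>u \<omega>\<bar>" p] powr_ge_zero[of "\<bar>u \<omega>\<bar>" m]
      unfolding real_norm_def by linarith
  qed
qed measurable

text \<open>The conditional moment assumptions on the noise enter only through their consequences for products of a bounded
  function of the covariate with the noise or, for \<open>m \<ge> 2\<close>, with its square.\<close>

locale heavy_tailed_regression =
  iid_sample \<Omega> "S \<Otimes>\<^sub>M (borel :: real measure)" "\<lambda>i \<omega>. (X i \<omega>, Y i \<omega>)"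
  for \<Omega> :: "'w measure" and S :: "'x measure" and X :: "nat \<Rightarrow> 'w \<Rightarrow> 'x" and Y :: "nat \<Rightarrow> 'w \<Rightarrow> real" +
  fixes f0 :: "'x \<Rightarrow> real" and m M :: real
  assumes f0_measurable [measurable]: "f0 \<in> borel_measurable S"
    and m: "m > 1" and M: "M > 0"
    and noise_moment: "integrable \<Omega> (\<lambda>\<omega>. \<bar>Y 0 \<omega> - f0 (X 0 \<omega>)\<bar> powr m)"
    and noise_orthogonal: "\<And>g b. g \<in> borel_measurable S \<Longrightarrow> (\<And>x. x \<in> space S \<Longrightarrow> \<bar>g x\<bar> \<le> b) \<Longrightarrow>
      expectation (\<lambda>\<omega>. g (X 0 \<omega>) * (Y 0 \<omega> - f0 (X 0 \<omega>))) = 0"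
    and noise_variance: "m \<ge> 2 \<Longrightarrow> \<exists>V. \<forall>g\<in>borel_measurable S. \<forall>b. (\<forall>x\<in>space S. \<bar>g x\<bar> \<le> b) \<longrightarrow>
      expectation (\<lambda>\<omega>. (g (X 0 \<omega>))\<^sup>2 * (Y 0 \<omega> - f0 (X 0 \<omega>))\<^sup>2)
        \<le> V * expectation (\<lambda>\<omega>. (g (X 0 \<omega>))\<^sup>2)"
begin

abbreviation P :: "'x measure" where "P \<equiv> distr \<Omega> S (X 0)"

definition excess_loss :: "('x \<Rightarrow> real) \<Rightarrow> ('x \<Rightarrow> real) \<Rightarrow> 'x \<times> real \<Rightarrow> real" where
  "excess_loss fs f z = (snd z - f (fst z))\<^sup>2 - (snd z - fs (fst z))\<^sup>2"

text \<open>The random Lipschitz constant of the loss, see \<open>excess_loss_Lipschitz\<close>; the summand \<open>4 M\<close> accounts for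
  \<open>2 f0 - f - g\<close> and keeps the multiplier positive.\<close>

definition multiplier :: "'x \<times> real \<Rightarrow> real" where
  "multiplier z = 2 * \<bar>snd z - f0 (fst z)\<bar> + 4 * M"

definition admissible :: "('x \<Rightarrow> real) \<Rightarrow> bool" where
  "admissible f \<longleftrightarrow> f \<in> borel_measurable S \<and> (\<forall>x\<in>space S. \<bar>f x\<bar> \<le> M)"

lemma X_measurable [measurable]: "X i \<in> \<Omega> \<rightarrow>\<^sub>M S"
proof -
  have "fst \<circ> (\<lambda>\<omega>. (X i \<omega>, Y i \<omega>)) \<in> \<Omega> \<rightarrow>\<^sub>M S"
    by (rule measurable_comp[OF Z_measurable measurable_fst])
  then show ?thesis by (simp add: comp_def)
qed

lemma Y_measurable [measurable]: "Y i \<in> borel_measurable \<Omega>"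
proof -
  have "snd \<circ> (\<lambda>\<omega>. (X i \<omega>, Y i \<omega>)) \<in> borel_measurable \<Omega>"
    by (rule measurable_comp[OF Z_measurable measurable_snd])
  then show ?thesis by (simp add: comp_def)
qed

lemma fst_space: "z \<in> space (S \<Otimes>\<^sub>M (borel :: real measure)) \<Longrightarrow> fst z \<in> space S"
  by (auto simp: space_pair_measure)

lemma multiplier_pos: "multiplier z > 0"
  using M unfolding multiplier_def by (intro add_nonneg_pos) auto

lemma multiplier_measurable [measurable]: "multiplier \<in> borel_measurable (S \<Otimes>\<^sub>M borel)"
  unfolding multiplier_def[abs_def] by measurable

lemma excess_loss_measurable [measurable]:
  assumes [measurable]: "f \<in> borel_measurable S" "fs \<in> borel_measurable S"
  shows "excess_loss fs f \<in> borel_measurable (S \<Otimes>\<^sub>M borel)"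
  unfolding excess_loss_def[abs_def] by measurable

lemma noise_integrable: "integrable \<Omega> (\<lambda>\<omega>. Y 0 \<omega> - f0 (X 0 \<omega>))"
proof -
  have "integrable \<Omega> (\<lambda>\<omega>. \<bar>Y 0 \<omega> - f0 (X 0 \<omega>)\<bar> powr 1)"
    by (rule integrable_lower_power[OF _ _ _ noise_moment]) (use m in auto)
  then have "integrable \<Omega> (\<lambda>\<omega>. \<bar>Y 0 \<omega> - f0 (X 0 \<omega>)\<bar>)" by simp
  then show ?thesis by (rule integrable_abs_cancel) measurable
qed

lemma noise_square_integrable: "m \<ge> 2 \<Longrightarrow> integrable \<Omega> (\<lambda>\<omega>. (Y 0 \<omega> - f0 (X 0 \<omega>))\<^sup>2)"
  using integrable_lower_power[of "\<lambda>\<omega>. Y 0 \<omega> - f0 (X 0 \<omega>)" 2, OF _ _ _ noise_moment]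
  by (simp add: powr_numeral)

lemma multiplier_powr_integrable: "integrable_obs (\<lambda>z. multiplier z powr m)"
proof (rule integrable_obs_bound)
  show "integrable_obs (\<lambda>z. 4 powr m * \<bar>snd z - f0 (fst z)\<bar> powr m + (8 * M) powr m)"
    using noise_moment by simp
  fix z :: "'x \<times> real"
  let ?u = "\<bar>snd z - f0 (fst z)\<bar>"
  have "multiplier z \<le> max (4 * ?u) (8 * M)" unfolding multiplier_def by linarith
  then have "multiplier z powr m \<le> max (4 * ?u) (8 * M) powr m"
    using multiplier_pos[of z] m by (intro powr_mono2) auto
  also have "\<dots> \<le> (4 * ?u) powr m + (8 * M) powr m"
    by (cases "4 * ?u \<le> 8 * M") (auto simp: max_def)
  also have "(4 * ?u) powr m = 4 powr m * ?u powr m" by (simp add: powr_mult)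
  finally show "\<bar>multiplier z powr m\<bar> \<le> 4 powr m * ?u powr m + (8 * M) powr m" by simp
qed measurable

lemma multiplier_integrable: "integrable_obs multiplier"
  using noise_integrable by (simp add: multiplier_def)

lemma L2_norm_square:
  assumes [measurable]: "g \<in> borel_measurable S"
  shows "(L2_norm P g)\<^sup>2 = mean (\<lambda>z. (g (fst z))\<^sup>2)"
  by (simp add: L2_norm_def mean_def integral_distr)

lemma L2_norm_nonneg: "L2_norm P g \<ge> 0" by (simp add: L2_norm_def)

lemma admissible_diff_square_integrable:
  assumes "admissible f" "admissible g"
  shows "integrable_obs (\<lambda>z. (f (fst z) - g (fst z))\<^sup>2)"
proof (rule integrable_bounded_obs)
  have [measurable]: "f \<in> borel_measurable S" "g \<in> borel_measurable S"
    using assms by (auto simp: admissible_def)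
  show "(\<lambda>z. (f (fst z) - g (fst z))\<^sup>2) \<in> borel_measurable (S \<Otimes>\<^sub>M (borel :: real measure))"
    by measurable
  fix z assume "z \<in> space (S \<Otimes>\<^sub>M (borel :: real measure))"
  then have "\<bar>f (fst z)\<bar> \<le> M" "\<bar>g (fst z)\<bar> \<le> M" using assms fst_space by (auto simp: admissible_def)
  then have "\<bar>f (fst z) - g (fst z)\<bar> \<le> \<bar>2 * M\<bar>" by linarith
  then show "\<bar>(f (fst z) - g (fst z))\<^sup>2\<bar> \<le> (2 * M)\<^sup>2" by (simp add: abs_le_square_iff)
qed

lemma L2_norm_diff_square:
  assumes "admissible f" "admissible g"
  shows "(L2_norm P (\<lambda>x. f x - g x))\<^sup>2 = mean (\<lambda>z. (f (fst z) - g (fst z))\<^sup>2)"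
  using assms by (subst L2_norm_square) (auto simp: admissible_def)

lemma L2_norm_diff_le:
  assumes "admissible f" "admissible g"
    and c: "\<And>x. x \<in> space S \<Longrightarrow> \<bar>f x - g x\<bar> \<le> c" and "c \<ge> 0"
  shows "L2_norm P (\<lambda>x. f x - g x) \<le> c"
proof -
  have "mean (\<lambda>z. (f (fst z) - g (fst z))\<^sup>2) \<le> mean (\<lambda>_. c\<^sup>2)"
  proof (rule mean_mono[OF admissible_diff_square_integrable[OF assms(1,2)]])
    fix z assume "z \<in> space (S \<Otimes>\<^sub>M (borel :: real measure))"
    from c[OF fst_space[OF this]] \<open>c \<ge> 0\<close> show "(f (fst z) - g (fst z))\<^sup>2 \<le> c\<^sup>2"
      by (simp add: abs_le_square_iff[symmetric])
  qed simp
  then have "(L2_norm P (\<lambda>x. f x - g x))\<^sup>2 \<le> c\<^sup>2"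
    by (simp add: L2_norm_diff_square assms) (simp add: mean_def prob_space)
  then show ?thesis using \<open>c \<ge> 0\<close> by (rule power2_le_imp_le)
qed

lemma L2_norm_diff_square_quasi_triangle:
  assumes "admissible f" "admissible g" "admissible h"
  shows "(L2_norm P (\<lambda>x. f x - h x))\<^sup>2
    \<le> 2 * (L2_norm P (\<lambda>x. f x - g x))\<^sup>2 + 2 * (L2_norm P (\<lambda>x. h x - g x))\<^sup>2"
proof -
  note i = admissible_diff_square_integrable
  have "mean (\<lambda>z. (f (fst z) - h (fst z))\<^sup>2)
      \<le> mean (\<lambda>z. 2 * (f (fst z) - g (fst z))\<^sup>2 + 2 * (h (fst z) - g (fst z))\<^sup>2)"
  proof (rule mean_mono)
    fix z
    have "0 \<le> (f (fst z) + h (fst z) - 2 * g (fst z))\<^sup>2" by simp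
    then show "(f (fst z) - h (fst z))\<^sup>2 \<le> 2 * (f (fst z) - g (fst z))\<^sup>2 + 2 * (h (fst z) - g (fst z))\<^sup>2"
      by (simp add: power2_eq_square algebra_simps)
  qed (use assms i in auto)
  also have "\<dots> = 2 * mean (\<lambda>z. (f (fst z) - g (fst z))\<^sup>2) + 2 * mean (\<lambda>z. (h (fst z) - g (fst z))\<^sup>2)"
    using i[OF assms(1,2)] i[OF assms(3,2)] by (simp add: mean_def)
  finally show ?thesis by (simp add: L2_norm_diff_square assms)
qed

lemma excess_loss_Lipschitz:
  assumes "admissible f0" "admissible f" "admissible g"
    and z: "z \<in> space (S \<Otimes>\<^sub>M (borel :: real measure))"
  shows "\<bar>excess_loss fs f z - excess_loss fs g z\<bar> \<le> \<bar>f (fst z) - g (fst z)\<bar> * multiplier z"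
proof -
  have "excess_loss fs f z - excess_loss fs g z
      = (g (fst z) - f (fst z)) * (2 * snd z - f (fst z) - g (fst z))"
    by (simp add: excess_loss_def power2_eq_square algebra_simps)
  then have "\<bar>excess_loss fs f z - excess_loss fs g z\<bar>
      = \<bar>f (fst z) - g (fst z)\<bar> * \<bar>2 * snd z - f (fst z) - g (fst z)\<bar>"
    by (simp add: abs_mult abs_minus_commute)
  also have "\<dots> \<le> \<bar>f (fst z) - g (fst z)\<bar> * multiplier z"
  proof (rule mult_left_mono)
    have b: "\<bar>f0 (fst z)\<bar> \<le> M" "\<bar>f (fst z)\<bar> \<le> M" "\<bar>g (fst z)\<bar> \<le> M"
      using assms fst_space[OF z] by (auto simp: admissible_def)
    have "\<bar>2 * snd z - f (fst z) - g (fst z)\<bar>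
        \<le> \<bar>2 * (snd z - f0 (fst z))\<bar> + \<bar>2 * f0 (fst z) - f (fst z) - g (fst z)\<bar>"
      using abs_triangle_ineq[of "2 * (snd z - f0 (fst z))" "2 * f0 (fst z) - f (fst z) - g (fst z)"]
      by (simp add: algebra_simps)
    moreover have "\<bar>2 * f0 (fst z) - f (fst z) - g (fst z)\<bar> \<le> 4 * M" using b by linarith
    ultimately show "\<bar>2 * snd z - f (fst z) - g (fst z)\<bar> \<le> multiplier z"
      unfolding multiplier_def abs_mult by simp
  qed simp
  finally show ?thesis .
qed

lemma excess_loss_integrable:
  assumes "admissible f0" "admissible f" "admissible fs"
  shows "integrable_obs (excess_loss fs f)"
proof (rule integrable_obs_bound)
  show "excess_loss fs f \<in> borel_measurable (S \<Otimes>\<^sub>M borel)"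
    using assms by (intro excess_loss_measurable) (auto simp: admissible_def)
  show "integrable_obs (\<lambda>z. 2 * M * multiplier z)" using multiplier_integrable by simp
  fix z assume z: "z \<in> space (S \<Otimes>\<^sub>M (borel :: real measure))"
  then have b: "\<bar>f0 (fst z)\<bar> \<le> M" "\<bar>f (fst z)\<bar> \<le> M" "\<bar>fs (fst z)\<bar> \<le> M"
    using assms fst_space by (auto simp: admissible_def)
  have "\<bar>excess_loss fs f z\<bar> \<le> \<bar>f (fst z) - fs (fst z)\<bar> * multiplier z"
    using excess_loss_Lipschitz[OF assms z, of fs] by (simp add: excess_loss_def)
  also have "\<dots> \<le> 2 * M * multiplier z"
    using b multiplier_pos[of z] by (intro mult_right_mono) linarith+
  finally show "\<bar>excess_loss fs f z\<bar> \<le> 2 * M * multiplier z" .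
qed

text \<open>The cross term is the noise times a bounded function of the covariate, so it has mean zero.\<close>

lemma mean_excess_loss:
  assumes "admissible f0" "admissible f" "admissible fs"
  shows "mean (excess_loss fs f)
    = (L2_norm P (\<lambda>x. f x - f0 x))\<^sup>2 - (L2_norm P (\<lambda>x. fs x - f0 x))\<^sup>2"
proof -
  have [measurable]: "f \<in> borel_measurable S" "fs \<in> borel_measurable S"
    using assms by (auto simp: admissible_def)
  have gb: "\<bar>fs x - f x\<bar> \<le> 2 * M" if "x \<in> space S" for x
    using assms that by (auto simp: admissible_def dest!: bspec[where x=x])
  have orth: "mean (\<lambda>z. (fs (fst z) - f (fst z)) * (snd z - f0 (fst z))) = 0"
    unfolding mean_def using noise_orthogonal[of "\<lambda>x. fs x - f x" "2 * M"] gb by simp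
  have io: "integrable_obs (\<lambda>z. (fs (fst z) - f (fst z)) * (snd z - f0 (fst z)))"
  proof (rule integrable_obs_bound)
    show "integrable_obs (\<lambda>z. 2 * M * \<bar>snd z - f0 (fst z)\<bar>)" using noise_integrable by simp
    show "\<bar>(fs (fst z) - f (fst z)) * (snd z - f0 (fst z))\<bar> \<le> 2 * M * \<bar>snd z - f0 (fst z)\<bar>"
      if "z \<in> space (S \<Otimes>\<^sub>M (borel :: real measure))" for z
      unfolding abs_mult using gb[OF fst_space[OF that]] by (intro mult_right_mono) auto
  qed measurable
  have "excess_loss fs f = (\<lambda>z. (f (fst z) - f0 (fst z))\<^sup>2 - (fs (fst z) - f0 (fst z))\<^sup>2
      + 2 * ((fs (fst z) - f (fst z)) * (snd z - f0 (fst z))))"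
    by (auto simp: excess_loss_def power2_eq_square algebra_simps)
  then have "mean (excess_loss fs f) = mean (\<lambda>z. (f (fst z) - f0 (fst z))\<^sup>2)
      - mean (\<lambda>z. (fs (fst z) - f0 (fst z))\<^sup>2) + 2 * mean (\<lambda>z. (fs (fst z) - f (fst z)) * (snd z - f0 (fst z)))"
    using io admissible_diff_square_integrable[OF assms(2,1)]
      admissible_diff_square_integrable[OF assms(3,1)] by (simp add: mean_def)
  then show ?thesis by (simp add: orth L2_norm_diff_square assms)
qed

text \<open>The bounded conditional variance lets the second moment of a link be measured by its \<open>L\<^sup>2\<close> distance, which can
  be much smaller than its uniform distance.\<close>

lemma excess_loss_link_variance:
  assumes "m \<ge> 2" and f0: "admissible f0"
  shows "\<exists>K>0. \<forall>f g fs B. admissible f \<longrightarrow> admissible g \<longrightarrow> admissible fs \<longrightarrow>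
    mean (\<lambda>z. (if multiplier z \<le> B then excess_loss fs f z - excess_loss fs g z else 0)\<^sup>2)
      \<le> K * (L2_norm P (\<lambda>x. f x - g x))\<^sup>2"
proof -
  obtain V where V: "\<And>g b. g \<in> borel_measurable S \<Longrightarrow> (\<forall>x\<in>space S. \<bar>g x\<bar> \<le> b) \<Longrightarrow>
      expectation (\<lambda>\<omega>. (g (X 0 \<omega>))\<^sup>2 * (Y 0 \<omega> - f0 (X 0 \<omega>))\<^sup>2)
        \<le> V * expectation (\<lambda>\<omega>. (g (X 0 \<omega>))\<^sup>2)"
    using noise_variance[OF \<open>m \<ge> 2\<close>] by blast
  define K where "K = 8 * \<bar>V\<bar> + 32 * M\<^sup>2"
  have "K > 0" using M unfolding K_def by (intro add_nonneg_pos) auto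
  moreover have "mean (\<lambda>z. (if multiplier z \<le> B then excess_loss fs f z - excess_loss fs g z else 0)\<^sup>2)
      \<le> K * (L2_norm P (\<lambda>x. f x - g x))\<^sup>2"
    if adm: "admissible f" "admissible g" "admissible fs" for f g fs B
  proof -
    let ?T = "S \<Otimes>\<^sub>M (borel :: real measure)"
    have [measurable]: "f \<in> borel_measurable S" "g \<in> borel_measurable S" "fs \<in> borel_measurable S"
      using adm by (auto simp: admissible_def)
    define d where "d z = (f (fst z) - g (fst z))\<^sup>2" for z :: "'x \<times> real"
    define e where "e z = d z * (snd z - f0 (fst z))\<^sup>2" for z
    have [measurable]: "d \<in> borel_measurable ?T" "e \<in> borel_measurable ?T"
      unfolding d_def e_def by measurable
    have db: "\<bar>f x - g x\<bar> \<le> 2 * M" if "x \<in> space S" for x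
      using adm that by (auto simp: admissible_def dest!: bspec[where x=x])
    have di: "integrable_obs d" unfolding d_def by (rule admissible_diff_square_integrable[OF adm(1,2)])
    have ei: "integrable_obs e"
    proof (rule integrable_obs_bound)
      show "integrable_obs (\<lambda>z. (2 * M)\<^sup>2 * (snd z - f0 (fst z))\<^sup>2)"
        using noise_square_integrable[OF \<open>m \<ge> 2\<close>] by simp
      show "\<bar>e z\<bar> \<le> (2 * M)\<^sup>2 * (snd z - f0 (fst z))\<^sup>2" if "z \<in> space ?T" for z
      proof -
        have "\<bar>f (fst z) - g (fst z)\<bar> \<le> \<bar>2 * M\<bar>" using db[OF fst_space[OF that]] by simp
        then have "d z \<le> (2 * M)\<^sup>2" unfolding d_def by (simp only: abs_le_square_iff)
        then show ?thesis unfolding e_def abs_mult by (intro mult_mono) (auto simp: d_def)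
      qed
    qed measurable
    have pw: "(if multiplier z \<le> B then excess_loss fs f z - excess_loss fs g z else 0)\<^sup>2
        \<le> 8 * e z + 32 * M\<^sup>2 * d z" if z: "z \<in> space ?T" for z
    proof -
      from excess_loss_Lipschitz[OF f0 adm(1,2) z, of fs]
      have "\<bar>excess_loss fs f z - excess_loss fs g z\<bar> \<le> \<bar>\<bar>f (fst z) - g (fst z)\<bar> * multiplier z\<bar>" by linarith
      then have "(excess_loss fs f z - excess_loss fs g z)\<^sup>2 \<le> (\<bar>f (fst z) - g (fst z)\<bar> * multiplier z)\<^sup>2"
        by (simp only: abs_le_square_iff)
      also have "\<dots> = d z * (multiplier z)\<^sup>2" by (simp add: d_def power_mult_distrib)
      also have "\<dots> \<le> d z * (8 * (snd z - f0 (fst z))\<^sup>2 + 32 * M\<^sup>2)"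
      proof (rule mult_left_mono)
        have "0 \<le> (2 * \<bar>snd z - f0 (fst z)\<bar> - 4 * M)\<^sup>2" by simp
        then show "(multiplier z)\<^sup>2 \<le> 8 * (snd z - f0 (fst z))\<^sup>2 + 32 * M\<^sup>2"
          unfolding multiplier_def power2_sum power2_diff power_mult_distrib power2_abs by simp
      qed (simp add: d_def)
      also have "\<dots> = 8 * e z + 32 * M\<^sup>2 * d z" by (simp add: e_def algebra_simps)
      finally have *: "(excess_loss fs f z - excess_loss fs g z)\<^sup>2 \<le> 8 * e z + 32 * M\<^sup>2 * d z" .
      then have "0 \<le> 8 * e z + 32 * M\<^sup>2 * d z" by (rule order_trans[rotated]) simp
      with * show ?thesis by simp
    qed
    have i1: "integrable_obs (\<lambda>z. 8 * e z + 32 * M\<^sup>2 * d z)" using di ei by simp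
    have i0: "integrable_obs (\<lambda>z. (if multiplier z \<le> B then excess_loss fs f z - excess_loss fs g z else 0)\<^sup>2)"
      by (rule integrable_obs_bound[OF _ i1]) (use pw in auto)
    have "mean (\<lambda>z. (if multiplier z \<le> B then excess_loss fs f z - excess_loss fs g z else 0)\<^sup>2)
        \<le> mean (\<lambda>z. 8 * e z + 32 * M\<^sup>2 * d z)"
      by (rule mean_mono[OF i0 i1 pw])
    also have "\<dots> = 8 * mean e + 32 * M\<^sup>2 * mean d" using di ei by (simp add: mean_def)
    also have "mean e \<le> V * mean d"
      unfolding mean_def e_def d_def using V[of "\<lambda>x. f x - g x" "2 * M"] db by simp
    also have "V * mean d \<le> \<bar>V\<bar> * mean d"
      by (intro mult_right_mono) (auto simp: mean_def d_def)
    finally have "mean (\<lambda>z. (if multiplier z \<le> B then excess_loss fs f z - excess_loss fs g z else 0)\<^sup>2)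
        \<le> K * mean d" by (simp add: K_def algebra_simps)
    then show ?thesis by (simp add: L2_norm_diff_square adm d_def[abs_def])
  qed
  ultimately show ?thesis by blast
qed

text \<open>When the noise may have infinite variance, truncation at \<open>B\<close> trades the missing moments for a power of
  \<open>B\<close>. The uniform distance suffices here: with \<open>B = \<rho> powr (- 1 / m)\<close> the resulting variance term
  is of the same size as the truncation term.\<close>

lemma truncated_link_second_moment:
  assumes "m < 2" and adm: "admissible f0" "admissible f" "admissible g" "admissible fs"
    and c: "\<And>x. x \<in> space S \<Longrightarrow> \<bar>f x - g x\<bar> \<le> c" and "B > 0"
  shows "mean (\<lambda>z. (if multiplier z \<le> B then excess_loss fs f z - excess_loss fs g z else 0)\<^sup>2)
      \<le> c\<^sup>2 * B powr (2 - m) * mean (\<lambda>z. multiplier z powr m)"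
proof -
  let ?T = "S \<Otimes>\<^sub>M (borel :: real measure)"
  have [measurable]: "f \<in> borel_measurable S" "g \<in> borel_measurable S" "fs \<in> borel_measurable S"
    using adm by (auto simp: admissible_def)
  have pw: "(if multiplier z \<le> B then excess_loss fs f z - excess_loss fs g z else 0)\<^sup>2
      \<le> c\<^sup>2 * B powr (2 - m) * multiplier z powr m" if z: "z \<in> space ?T" for z
  proof (cases "multiplier z \<le> B")
    case True
    have p: "multiplier z > 0" by (rule multiplier_pos)
    from excess_loss_Lipschitz[OF adm(1,2,3) z, of fs]
    have "\<bar>excess_loss fs f z - excess_loss fs g z\<bar> \<le> \<bar>f (fst z) - g (fst z)\<bar> * multiplier z" .
    also have "\<dots> \<le> c * multiplier z"
      using c[OF fst_space[OF z]] p by (intro mult_right_mono) auto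
    finally have "\<bar>excess_loss fs f z - excess_loss fs g z\<bar> \<le> \<bar>c * multiplier z\<bar>" by simp
    then have "(excess_loss fs f z - excess_loss fs g z)\<^sup>2 \<le> (c * multiplier z)\<^sup>2"
      by (simp only: abs_le_square_iff)
    also have "\<dots> = c\<^sup>2 * (multiplier z powr (2 - m) * multiplier z powr m)"
      using p by (simp add: power_mult_distrib powr_add[symmetric] powr_numeral)
    also have "\<dots> \<le> c\<^sup>2 * (B powr (2 - m) * multiplier z powr m)"
      using True p \<open>m < 2\<close> by (intro mult_left_mono mult_right_mono powr_mono2) auto
    finally show ?thesis using True by (simp add: mult.assoc)
  qed simp
  have i1: "integrable_obs (\<lambda>z. c\<^sup>2 * B powr (2 - m) * multiplier z powr m)"
    using multiplier_powr_integrable by simp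
  have i0: "integrable_obs (\<lambda>z. (if multiplier z \<le> B then excess_loss fs f z - excess_loss fs g z else 0)\<^sup>2)"
    by (rule integrable_obs_bound[OF _ i1]) (use pw in auto)
  from mean_mono[OF i0 i1 pw] show ?thesis by (simp add: mean_def)
qed

section \<open>Deviations over an L2 ball\<close>

definition L2_ball :: "('x \<Rightarrow> real) set \<Rightarrow> ('x \<Rightarrow> real) \<Rightarrow> real \<Rightarrow> ('x \<Rightarrow> real) set" where
  "L2_ball F fs t = {f\<in>F. L2_norm P (\<lambda>x. f x - fs x) \<le> t}"

definition regular_class ::
  "real \<Rightarrow> real \<Rightarrow> real \<Rightarrow> real \<Rightarrow> real \<Rightarrow> real \<Rightarrow> ('x \<Rightarrow> real) set \<Rightarrow> real \<Rightarrow> bool" where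
  "regular_class \<gamma> C0 U a0 s C1 F D \<longleftrightarrow>
     (\<forall>f\<in>F. admissible f) \<and> admissible f0 \<and> D \<ge> 1 \<and>
     entropy_condition (space S) \<gamma> C0 U a0 F D \<and> envelope_condition P s C1 F"

text \<open>The chaining bound with scales \<open>x k = \<sigma> / 2 ^ k\<close> from \<open>\<sigma> = c * t powr s\<close> down to
  \<open>t * \<delta>\<close>. Each of the \<open>O(log n)\<close> links contributes at most a multiple of \<open>\<Lambda> * (t * \<delta>)\<close>, where
  \<open>\<Lambda>\<close> collects the logarithmic factor of the entropy bound.\<close>

lemma localised_deviation:
  assumes "\<gamma> \<ge> 0" "C0 > 0" "U \<ge> 1" "a0 \<ge> 0" "0 \<le> s" "s \<le> 1" "T \<ge> 1"
  shows "\<exists>C>0. \<forall>n F D fs \<delta> t. n \<ge> 1 \<longrightarrow> D \<le> real n \<longrightarrow>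
    regular_class \<gamma> C0 U a0 s C1 F D \<longrightarrow> fs \<in> F \<longrightarrow>
    0 < \<delta> \<longrightarrow> \<delta> \<le> 2 \<longrightarrow> 1 / real n \<le> \<delta>\<^sup>2 \<longrightarrow> 1 / (real n / D) \<le> \<delta> powr (2 * \<gamma>) \<longrightarrow>
    1 / (real n / D) \<le> \<delta> powr (2 + \<gamma>) \<longrightarrow>
    1 / (real n / D) \<le> \<delta> powr ((2 - s) / (1 - 1 / m) + s * \<gamma>) \<longrightarrow>
    \<delta> \<le> t \<longrightarrow> t \<le> T \<longrightarrow>
    (\<exists>V. integrable \<Omega> V \<and>
      (\<forall>f\<in>L2_ball F fs t. \<forall>\<omega>\<in>space \<Omega>. \<bar>dev n (excess_loss fs f) \<omega>\<bar> \<le> V \<omega>) \<and>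
      expectation V \<le> C * log_plus (real n) powr (a0 + 1) * (t * \<delta>))"
proof -
  define q where "q = 1 - 1 / m"
  have q: "0 < q" "q \<le> 1" using m by (auto simp: q_def)
  define c where "c = max C1 0 + 1"
  have c: "c \<ge> 1" "max C1 0 \<le> c" by (auto simp: c_def)
  define L where "L = 1 + ln (2 * U)"
  have L: "L \<ge> 1" using \<open>U \<ge> 1\<close> by (simp add: L_def)
  \<comment> \<open>the summand \<open>1\<close> only makes positivity immediate\<close>
  define A where "A = mean (\<lambda>z. multiplier z powr m) + 1"
  have A: "A \<ge> 1" "mean (\<lambda>z. multiplier z powr m) \<le> A" "A > 0"
    unfolding A_def mean_def by (auto intro!: add_increasing add_nonneg_pos)
  have "\<exists>Q>0. m \<ge> 2 \<longrightarrow> admissible f0 \<longrightarrow> (\<forall>f g fs B. admissible f \<longrightarrow> admissible g \<longrightarrow> admissible fs \<longrightarrow>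
    mean (\<lambda>z. (if multiplier z \<le> B then excess_loss fs f z - excess_loss fs g z else 0)\<^sup>2)
      \<le> Q * (L2_norm P (\<lambda>x. f x - g x))\<^sup>2)"
    using excess_loss_link_variance by (cases "m \<ge> 2 \<and> admissible f0") (blast, force intro: zero_less_one)
  then obtain Q where Q: "Q > 0" "\<And>f g fs B. m \<ge> 2 \<Longrightarrow> admissible f0 \<Longrightarrow> admissible f \<Longrightarrow> admissible g \<Longrightarrow>
    admissible fs \<Longrightarrow> mean (\<lambda>z. (if multiplier z \<le> B then excess_loss fs f z - excess_loss fs g z else 0)\<^sup>2)
      \<le> Q * (L2_norm P (\<lambda>x. f x - g x))\<^sup>2" by blast
  \<comment> \<open>the first summand absorbs the constant \<open>ln 2\<close> of the maximal inequality, since all scales are at most \<open>c * T\<close>\<close>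
  define C\<Lambda> where "C\<Lambda> = (c * T) powr \<gamma> + 2 * C0 * L powr a0"
  have cT: "c * T \<ge> 1" using c \<open>T \<ge> 1\<close> mult_mono[of 1 c 1 T] by simp
  have C\<Lambda>: "C\<Lambda> \<ge> 1" unfolding C\<Lambda>_def
    using ge_one_powr_ge_zero[OF cT \<open>\<gamma> \<ge> 0\<close>] \<open>C0 > 0\<close> by (simp add: add_increasing2)
  define C2 where "C2 = (12 * (1 + A) + 12 * (sqrt Q + sqrt A)) * (2 powr \<gamma> + c)"
  have C2: "C2 \<ge> 0" unfolding C2_def using A Q c by (intro mult_nonneg_nonneg) auto
  define C3 where "C3 = 2 + 2 * ln (2 * (c * T))"
  have C3: "C3 \<ge> 0" using cT by (simp add: C3_def)
  define E where "E = mean multiplier"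
  have E: "E \<ge> 0" unfolding E_def mean_def by (simp add: less_imp_le[OF multiplier_pos])
  define C where "C = C3 * (C2 * C\<Lambda>) + 4 * E + 1"
  have C: "C > 0" unfolding C_def using C3 C2 C\<Lambda> E
    by (intro add_nonneg_pos add_nonneg_nonneg mult_nonneg_nonneg) auto
  have "\<exists>V. integrable \<Omega> V \<and>
      (\<forall>f\<in>L2_ball F fs t. \<forall>\<omega>\<in>space \<Omega>. \<bar>dev n (excess_loss fs f) \<omega>\<bar> \<le> V \<omega>) \<and>
      expectation V \<le> C * log_plus (real n) powr (a0 + 1) * (t * \<delta>)"
    if n: "n \<ge> 1" and D: "D \<le> real n" and reg: "regular_class \<gamma> C0 U a0 s C1 F D" and fs: "fs \<in> F"
      and \<delta>: "0 < \<delta>" "\<delta> \<le> 2" and d0: "1 / real n \<le> \<delta>\<^sup>2" and d1: "1 / (real n / D) \<le> \<delta> powr (2 * \<gamma>)"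
      and d2: "1 / (real n / D) \<le> \<delta> powr (2 + \<gamma>)"
      and d3: "1 / (real n / D) \<le> \<delta> powr ((2 - s) / (1 - 1 / m) + s * \<gamma>)"
      and t: "\<delta> \<le> t" "t \<le> T" for n F D fs \<delta> t
  proof -
    have D1: "D \<ge> 1" and adm: "\<And>f. f \<in> F \<Longrightarrow> admissible f" and adm0: "admissible f0"
      and ent: "entropy_condition (space S) \<gamma> C0 U a0 F D" and env: "envelope_condition P s C1 F"
      using reg by (auto simp: regular_class_def)
    define l where "l = log_plus (real n)"
    have l: "l \<ge> 1" by (simp add: l_def log_plus_ge)
    define N where "N = real n / D"
    have N: "N > 0" using n D1 by (simp add: N_def)
    have tp: "t > 0" using \<delta> t by linarith
    have t\<delta>: "t * \<delta> > 0" using tp \<delta> by simp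
    have t\<delta>n: "1 / real n \<le> t * \<delta>"
    proof -
      have "\<delta> * \<delta> \<le> t * \<delta>" using t \<delta> by (intro mult_right_mono) auto
      then show ?thesis using d0 by (simp add: power2_eq_square)
    qed
    define \<Lambda> where "\<Lambda> = C\<Lambda> * l powr a0"
    have la: "l powr a0 \<ge> 1" using l \<open>a0 \<ge> 0\<close> by (rule ge_one_powr_ge_zero)
    have \<Lambda>: "\<Lambda> \<ge> 1" unfolding \<Lambda>_def using C\<Lambda> la mult_mono[of 1 C\<Lambda> 1 "l powr a0"] by simp
    define \<sigma> where "\<sigma> = c * t powr s"
    have \<sigma>: "\<sigma> > 0" using c tp by (simp add: \<sigma>_def)
    have \<sigma>T: "\<sigma> \<le> c * T"
    proof -
      have "t powr s \<le> T powr s" using t tp \<open>0 \<le> s\<close> by (intro powr_mono2) auto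
      also have "\<dots> \<le> T powr 1" using \<open>T \<ge> 1\<close> \<open>s \<le> 1\<close> by (intro powr_mono) auto
      finally show ?thesis using c \<open>T \<ge> 1\<close> by (simp add: \<sigma>_def)
    qed
    define G where "G = L2_ball F fs t"
    have GF: "G \<subseteq> F" by (auto simp: G_def L2_ball_def)
    have fsG: "fs \<in> G" using fs tp by (simp add: G_def L2_ball_def L2_norm_def)
    have G_adm: "admissible f" if "f \<in> G" for f using that GF adm by auto
    have G\<sigma>: "\<bar>f x - fs x\<bar> \<le> \<sigma>" if "f \<in> G" "x \<in> space S" for f x
    proof -
      have "\<bar>f x - fs x\<bar> \<le> max C1 0 * t powr s"
        using that fs GF by (intro L2_radius_imp_uniform[OF env _ \<open>0 \<le> s\<close> tp]) (auto simp: G_def L2_ball_def)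
      also have "\<dots> \<le> \<sigma>" unfolding \<sigma>_def using c by (intro mult_right_mono) auto
      finally show ?thesis .
    qed
    define x where "x k = \<sigma> / 2 ^ k" for k :: nat
    have xp: "x k > 0" for k using \<sigma> by (simp add: x_def)
    have xS: "x k = 2 * x (Suc k)" for k by (simp add: x_def)
    have x\<sigma>: "x k \<le> \<sigma>" for k
      using \<sigma> divide_left_mono[of 1 "2 ^ k" \<sigma>] by (simp add: x_def)
    obtain k0 where "\<sigma> / (t * \<delta>) < 2 ^ k0" using real_arch_pow[of 2 "\<sigma> / (t * \<delta>)"] by auto
    then have k0: "x k0 \<le> t * \<delta>" using t\<delta> by (simp add: x_def field_simps)
    \<comment> \<open>the last scale lies in \<open>[t \<delta> / 2, t \<delta>]\<close> unless no link is needed at all\<close>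
    define K where "K = (LEAST k. x k \<le> t * \<delta>)"
    have xK: "x K \<le> t * \<delta>" unfolding K_def by (rule LeastI[where P = "\<lambda>k. x k \<le> t * \<delta>", OF k0])
    have xlow: "x k > t * \<delta>" if "k < K" for k using not_less_Least[of k "\<lambda>k. x k \<le> t * \<delta>"] that by (auto simp: K_def)
    have xlow': "t * \<delta> / 2 \<le> x (Suc k)" if "k < K" for k using xlow[OF that] xS[of k] by simp
    have Kl: "real K \<le> C3 * l" unfolding C3_def l_def
    proof (rule dyadic_count)
      show "2 ^ K \<le> 2 * (c * T) * real n"
      proof (cases K)
        case 0
        have "1 * 1 \<le> 2 * (c * T) * real n" using cT n by (intro mult_mono) auto
        then show ?thesis using 0 by simp
      next
        case (Suc k)
        then have "t * \<delta> < \<sigma> / 2 ^ k" using xlow[of k] by (simp add: x_def)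
        then have "1 / real n < c * T / 2 ^ k"
          using t\<delta>n divide_right_mono[OF \<sigma>T, of "2 ^ k"] by simp
        then show ?thesis using Suc n by (simp add: field_simps)
      qed
    qed (use cT n in auto)
    \<comment> \<open>level \<open>0\<close> is the single point \<open>fs\<close>, where the excess loss vanishes, so that the chain starts at zero\<close>
    define H where "H k = C0 * D * x k powr (- \<gamma>) * log_plus (U / x k) powr a0" for k
    have "\<forall>k. \<exists>Nk\<subseteq>G. finite Nk \<and> Nk \<noteq> {} \<and> ln (real (card Nk)) \<le> H k \<and>
       (\<forall>f\<in>G. \<exists>g\<in>Nk. \<forall>z\<in>space S. \<bar>f z - g z\<bar> \<le> 2 * x k) \<and> (k = 0 \<longrightarrow> Nk = {fs})"
    proof
      fix k
      show "\<exists>Nk\<subseteq>G. finite Nk \<and> Nk \<noteq> {} \<and> ln (real (card Nk)) \<le> H k \<and>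
       (\<forall>f\<in>G. \<exists>g\<in>Nk. \<forall>z\<in>space S. \<bar>f z - g z\<bar> \<le> 2 * x k) \<and> (k = 0 \<longrightarrow> Nk = {fs})"
      proof (cases "k = 0")
        case True
        have "\<bar>f z - fs z\<bar> \<le> 2 * x 0" if "f \<in> G" "z \<in> space S" for f z
          using G\<sigma>[OF that] \<sigma> by (simp add: x_def)
        moreover have "0 \<le> H 0" unfolding H_def using \<open>C0 > 0\<close> D1 by (intro mult_nonneg_nonneg) auto
        ultimately show ?thesis using True fsG by (intro exI[of _ "{fs}"]) auto
      next
        case False
        then show ?thesis using internal_net[OF ent xp GF, of k] fsG unfolding H_def by blast
      qed
    qed
    then obtain Nt where Nt: "\<And>k. Nt k \<subseteq> G" "\<And>k. finite (Nt k)" "\<And>k. Nt k \<noteq> {}"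
      "\<And>k. ln (real (card (Nt k))) \<le> H k" "Nt 0 = {fs}"
      "\<And>k f. f \<in> G \<Longrightarrow> \<exists>g\<in>Nt k. \<forall>z\<in>space S. \<bar>f z - g z\<bar> \<le> 2 * x k"
      unfolding choice_iff by metis
    then have "\<forall>k f. f \<in> G \<longrightarrow> (\<exists>g. g \<in> Nt k \<and> (\<forall>z\<in>space S. \<bar>f z - g z\<bar> \<le> 2 * x k))" by blast
    then obtain \<pi> where \<pi>: "\<And>k f. f \<in> G \<Longrightarrow> \<pi> k f \<in> Nt k"
      "\<And>k f z. f \<in> G \<Longrightarrow> z \<in> space S \<Longrightarrow> \<bar>f z - \<pi> k f z\<bar> \<le> 2 * x k"
      by metis
    have \<pi>G: "\<pi> k f \<in> G" if "f \<in> G" for k f using \<pi>(1)[OF that] Nt(1) by blast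
    have \<pi>link: "\<bar>\<pi> (Suc k) f z - \<pi> k f z\<bar> \<le> 6 * x (Suc k)" if "f \<in> G" "z \<in> space S" for k f z
      using \<pi>(2)[OF that, of k] \<pi>(2)[OF that, of "Suc k"] xS[of k] by linarith
    \<comment> \<open>\<open>\<rho> k\<close> bounds the log-cardinality of the links at level \<open>k\<close> per observation, \<open>B k\<close> is the truncation level and \<open>v k\<close> bounds the truncated second moments; a link has \<open>L\<^sup>2\<close> length at most \<open>2 t\<close> and uniform length at most \<open>6 * x (Suc k)\<close>\<close>
    define r where "r k = x (Suc k) powr (- \<gamma>) / N" for k
    define \<rho> where "\<rho> k = \<Lambda> * r k" for k
    have rp: "r k > 0" for k using xp[of "Suc k"] N by (simp add: r_def)
    have \<rho>p: "\<rho> k > 0" for k using rp[of k] \<Lambda> by (simp add: \<rho>_def)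
    define B where "B k = \<rho> k powr (- 1 / m)" for k
    have Bp: "B k > 0" for k using \<rho>p[of k] by (simp add: B_def)
    define v where "v k = (if m \<ge> 2 then Q * (6 * min t (x (Suc k)))\<^sup>2
        else (6 * x (Suc k))\<^sup>2 * B k powr (2 - m) * A)" for k
    have vp: "v k > 0" for k
      using Q(1) tp xp[of "Suc k"] Bp[of k] A by (auto simp: v_def)
    have Hle: "H j \<le> C0 * D * x (Suc k) powr (- \<gamma>) * (L * l) powr a0"
      if "k < K" "j = k \<or> j = Suc k" for j k
    proof -
      have xj: "x (Suc k) \<le> x j" using that xp[of "Suc k"] xS[of k] by auto
      have "1 / (2 * real n) \<le> x j"
        using xj xlow'[OF that(1)] t\<delta>n by (simp add: field_simps)
      then have "log_plus (U / x j) \<le> L * l"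
        unfolding L_def l_def using \<open>U \<ge> 1\<close> n by (intro log_plus_quotient) auto
      then have "log_plus (U / x j) powr a0 \<le> (L * l) powr a0"
        using \<open>a0 \<ge> 0\<close> log_plus_ge(3)[of "U / x j"] by (intro powr_mono2) auto
      moreover have "x j powr (- \<gamma>) \<le> x (Suc k) powr (- \<gamma>)"
        using xj xp[of "Suc k"] \<open>\<gamma> \<ge> 0\<close> by (intro powr_mono2') auto
      ultimately show ?thesis unfolding H_def using \<open>C0 > 0\<close> D1 by (intro mult_mono) auto
    qed
    have ent_le: "ln (2 * (real (card (Nt (Suc k))) * real (card (Nt k)))) \<le> real n * \<rho> k" if "k < K" for k
    proof -
      have cp: "real (card (Nt j)) > 0" for j using Nt(2,3)[of j] by (simp add: card_gt_0_iff)
      have "ln (2 * (real (card (Nt (Suc k))) * real (card (Nt k))))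
          = ln 2 + (ln (real (card (Nt (Suc k)))) + ln (real (card (Nt k))))"
        using cp[of k] cp[of "Suc k"] by (simp add: ln_mult)
      also have "\<dots> \<le> 1 + (H (Suc k) + H k)"
        using ln_2_less_1 Nt(4)[of k] Nt(4)[of "Suc k"] by linarith
      also have "\<dots> \<le> 1 + 2 * (C0 * D * x (Suc k) powr (- \<gamma>) * (L * l) powr a0)"
        using Hle[OF that, of k] Hle[OF that, of "Suc k"] by simp
      also have "1 \<le> D * x (Suc k) powr (- \<gamma>) * ((c * T) powr \<gamma> * l powr a0)"
      proof -
        have "(c * T) powr (- \<gamma>) \<le> x (Suc k) powr (- \<gamma>)"
          using xp[of "Suc k"] x\<sigma>[of "Suc k"] \<sigma>T \<open>\<gamma> \<ge> 0\<close> by (intro powr_mono2') auto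
        then have "(c * T) powr (- \<gamma>) * (c * T) powr \<gamma> \<le> x (Suc k) powr (- \<gamma>) * (c * T) powr \<gamma>"
          by (intro mult_right_mono) auto
        moreover have "(c * T) powr (- \<gamma>) * (c * T) powr \<gamma> = 1"
          using c \<open>T \<ge> 1\<close> by (simp add: powr_add[symmetric])
        ultimately have "1 \<le> x (Suc k) powr (- \<gamma>) * (c * T) powr \<gamma>" by simp
        then have "1 * (1 * 1) \<le> D * ((x (Suc k) powr (- \<gamma>) * (c * T) powr \<gamma>) * l powr a0)"
          using D1 la by (intro mult_mono) auto
        then show ?thesis by (simp add: mult_ac)
      qed
      also have "D * x (Suc k) powr (- \<gamma>) * ((c * T) powr \<gamma> * l powr a0)
          + 2 * (C0 * D * x (Suc k) powr (- \<gamma>) * (L * l) powr a0)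
          = D * x (Suc k) powr (- \<gamma>) * \<Lambda>"
        using L l by (simp add: \<Lambda>_def C\<Lambda>_def powr_mult algebra_simps)
      also have "\<dots> = real n * \<rho> k"
        using n D1 by (simp add: \<rho>_def r_def N_def)
      finally show ?thesis by simp
    qed
    have rate: "x (Suc k) * r k powr q \<le> (2 powr \<gamma> + c) * (t * \<delta>)"
      "min t (x (Suc k)) * sqrt (r k) \<le> (2 powr \<gamma> + c) * (t * \<delta>)" if "k < K" for k
    proof -
      show "x (Suc k) * r k powr q \<le> (2 powr \<gamma> + c) * (t * \<delta>)" unfolding r_def
        by (rule scale_bound[OF N \<delta>(1) t(1) q \<open>\<gamma> \<ge> 0\<close> \<open>0 \<le> s\<close> \<open>s \<le> 1\<close> c(1)])
          (use d1 d3 xlow'[OF that] x\<sigma>[of "Suc k"] in \<open>auto simp: N_def q_def \<sigma>_def\<close>)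
      have "min t (x (Suc k)) * sqrt (r k) \<le> (2 powr \<gamma> + 1) * (t * \<delta>)" unfolding r_def
        by (rule variance_scale_bound[OF N \<delta>(1) t(1) \<delta>(2) \<open>\<gamma> \<ge> 0\<close>])
          (use d1 d2 xlow'[OF that] in \<open>auto simp: N_def\<close>)
      also have "\<dots> \<le> (2 powr \<gamma> + c) * (t * \<delta>)" using c t\<delta> by (intro mult_right_mono) auto
      finally show "min t (x (Suc k)) * sqrt (r k) \<le> (2 powr \<gamma> + c) * (t * \<delta>)" .
    qed
    have pq: "x (Suc k) * \<rho> k powr q \<le> \<Lambda> * ((2 powr \<gamma> + c) * (t * \<delta>))" if "k < K" for k
    proof -
      have "\<Lambda> powr q \<le> \<Lambda> powr 1" using \<Lambda> q by (intro powr_mono) auto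
      then have le: "\<Lambda> powr q \<le> \<Lambda>" using \<Lambda> by simp
      have "\<Lambda> powr q * (x (Suc k) * r k powr q) \<le> \<Lambda> * ((2 powr \<gamma> + c) * (t * \<delta>))"
        by (rule mult_mono[OF le rate(1)[OF that]]) (use \<Lambda> xp[of "Suc k"] in auto)
      then show ?thesis using \<Lambda> rp[of k] by (simp add: \<rho>_def powr_mult mult_ac)
    qed
    have sv: "sqrt (\<rho> k * v k) \<le> 6 * (sqrt Q + sqrt A) * (\<Lambda> * ((2 powr \<gamma> + c) * (t * \<delta>)))" if "k < K" for k
    proof -
      define R where "R = \<Lambda> * ((2 powr \<gamma> + c) * (t * \<delta>))"
      have R: "R \<ge> 0" unfolding R_def using \<Lambda> c tp \<delta> by (intro mult_nonneg_nonneg) auto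
      have sq: "sqrt Q \<ge> 0" "sqrt A \<ge> 0" using Q A by auto
      show ?thesis
      proof (cases "m \<ge> 2")
        case True
        have le: "sqrt \<Lambda> \<le> \<Lambda>" using \<Lambda> by (intro real_le_lsqrt) (auto simp: power2_eq_square)
        have "sqrt \<Lambda> * (min t (x (Suc k)) * sqrt (r k)) \<le> R" unfolding R_def
          by (rule mult_mono[OF le rate(2)[OF that]]) (use \<Lambda> tp xp[of "Suc k"] rp[of k] in auto)
        then have "6 * sqrt Q * (sqrt \<Lambda> * (min t (x (Suc k)) * sqrt (r k))) \<le> 6 * sqrt Q * R"
          using sq by (intro mult_left_mono) auto
        moreover have "sqrt (\<rho> k * v k) = 6 * sqrt Q * (sqrt \<Lambda> * (min t (x (Suc k)) * sqrt (r k)))"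
          using True tp xp[of "Suc k"] by (simp add: \<rho>_def v_def real_sqrt_mult)
        moreover have "6 * sqrt Q * R \<le> 6 * (sqrt Q + sqrt A) * R"
          using R sq by (intro mult_right_mono) auto
        ultimately show ?thesis unfolding R_def by linarith
      next
        case False
        have "\<rho> k * v k = (6 * x (Suc k))\<^sup>2 * A * (\<rho> k * B k powr (2 - m))"
          using False by (simp add: v_def)
        also have "\<rho> k * B k powr (2 - m) = \<rho> k * \<rho> k powr ((- 1 / m) * (2 - m))"
          by (simp only: B_def powr_powr)
        also have "\<dots> = \<rho> k powr (1 + (- 1 / m) * (2 - m))"
          using \<rho>p[of k] by (intro powr_mult_base) auto
        also have "1 + (- 1 / m) * (2 - m) = q + q" using m by (simp add: q_def field_simps)
        also have "\<rho> k powr (q + q) = (\<rho> k powr q)\<^sup>2" by (simp only: powr_add power2_eq_square)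
        finally have "sqrt (\<rho> k * v k) = 6 * sqrt A * (x (Suc k) * \<rho> k powr q)"
          using xp[of "Suc k"] by (simp add: real_sqrt_mult)
        also have "\<dots> \<le> 6 * sqrt A * R" unfolding R_def
          using pq[OF that] sq by (intro mult_left_mono) auto
        also have "\<dots> \<le> 6 * (sqrt Q + sqrt A) * R"
          using R sq by (intro mult_right_mono) auto
        finally show ?thesis unfolding R_def .
      qed
    qed
    have "\<exists>V. integrable \<Omega> V \<and> (\<forall>f\<in>G. \<forall>\<omega>\<in>space \<Omega>. \<bar>dev n (excess_loss fs f) \<omega>\<bar> \<le> V \<omega>) \<and>
      expectation V \<le> (\<Sum>k<K. 2 * (1 + A) * (6 * x (Suc k) * \<rho> k powr (1 - 1 / m)) + 2 * sqrt (\<rho> k * v k))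
        + 2 * (2 * x K) * mean multiplier"
    proof (rule chaining[where N = Nt and \<pi> = \<pi> and m = m])
      show "G \<noteq> {}" using fsG by blast
      show "n \<ge> 1" by (rule n)
      show "excess_loss fs f \<in> borel_measurable (S \<Otimes>\<^sub>M borel)" if "f \<in> G" for f
        using G_adm[OF that] adm[OF fs] by (intro excess_loss_measurable) (auto simp: admissible_def)
      show "integrable_obs (excess_loss fs f)" if "f \<in> G" for f
        by (rule excess_loss_integrable[OF adm0 G_adm[OF that] adm[OF fs]])
      show "excess_loss fs (\<pi> 0 f) z = 0" if "f \<in> G" for f z
        using \<pi>(1)[OF that, of 0] Nt(5) by (simp add: excess_loss_def)
      fix f assume f: "f \<in> G"
      fix z assume z: "z \<in> space (S \<Otimes>\<^sub>M (borel :: real measure))"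
      note p = less_imp_le[OF multiplier_pos[of z]]
      show "\<bar>excess_loss fs (\<pi> (Suc k) f) z - excess_loss fs (\<pi> k f) z\<bar> \<le> 6 * x (Suc k) * multiplier z" for k
        by (rule order_trans[OF excess_loss_Lipschitz[OF adm0 G_adm[OF \<pi>G[OF f]] G_adm[OF \<pi>G[OF f]] z]
              mult_right_mono[OF \<pi>link[OF f fst_space[OF z]] p]])
      show "\<bar>excess_loss fs f z - excess_loss fs (\<pi> K f) z\<bar> \<le> 2 * x K * multiplier z"
        by (rule order_trans[OF excess_loss_Lipschitz[OF adm0 G_adm[OF f] G_adm[OF \<pi>G[OF f]] z]
              mult_right_mono[OF \<pi>(2)[OF f fst_space[OF z]] p]])
    next
      fix f k assume f: "f \<in> G" and k: "k < K"
      let ?a = "\<pi> (Suc k) f" and ?b = "\<pi> k f"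
      have ab: "admissible ?a" "admissible ?b" using G_adm[OF \<pi>G[OF f]] by auto
      have "mean (\<lambda>z. (if multiplier z \<le> B k then excess_loss fs ?a z - excess_loss fs ?b z else 0)\<^sup>2) \<le> v k"
      proof (cases "m \<ge> 2")
        case True
        have "(L2_norm P (\<lambda>x. ?a x - ?b x))\<^sup>2 \<le> (6 * min t (x (Suc k)))\<^sup>2"
        proof (cases "t \<le> x (Suc k)")
          case True
          have "L2_norm P (\<lambda>x. ?a x - fs x) \<le> t" "L2_norm P (\<lambda>x. ?b x - fs x) \<le> t"
            using \<pi>G[OF f] by (auto simp: G_def L2_ball_def)
          then have "(L2_norm P (\<lambda>x. ?a x - fs x))\<^sup>2 \<le> t\<^sup>2" "(L2_norm P (\<lambda>x. ?b x - fs x))\<^sup>2 \<le> t\<^sup>2"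
            by (auto intro!: power_mono L2_norm_nonneg)
          then have "(L2_norm P (\<lambda>x. ?a x - ?b x))\<^sup>2 \<le> 4 * t\<^sup>2"
            using L2_norm_diff_square_quasi_triangle[OF ab(1) adm[OF fs] ab(2)] by linarith
          also have "\<dots> \<le> (6 * t)\<^sup>2" by (simp add: power_mult_distrib)
          finally show ?thesis using True by (simp add: min_absorb1)
        next
          case False
          then have "L2_norm P (\<lambda>x. ?a x - ?b x) \<le> 6 * min t (x (Suc k))"
            using \<pi>link[OF f] xp[of "Suc k"] ab by (intro L2_norm_diff_le) auto
          then show ?thesis by (intro power_mono L2_norm_nonneg)
        qed
        then have "Q * (L2_norm P (\<lambda>x. ?a x - ?b x))\<^sup>2 \<le> Q * (6 * min t (x (Suc k)))\<^sup>2"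
          using Q(1) by (intro mult_left_mono) auto
        with Q(2)[OF True adm0 ab adm[OF fs], of "B k"]
        have "mean (\<lambda>z. (if multiplier z \<le> B k then excess_loss fs ?a z - excess_loss fs ?b z else 0)\<^sup>2)
            \<le> Q * (6 * min t (x (Suc k)))\<^sup>2" by linarith
        then show ?thesis using True by (simp add: v_def)
      next
        case False
        have "mean (\<lambda>z. (if multiplier z \<le> B k then excess_loss fs ?a z - excess_loss fs ?b z else 0)\<^sup>2)
            \<le> (6 * x (Suc k))\<^sup>2 * B k powr (2 - m) * mean (\<lambda>z. multiplier z powr m)"
          by (rule truncated_link_second_moment[OF _ adm0 ab adm[OF fs] \<pi>link[OF f] Bp]) (use False in auto)
        also have "\<dots> \<le> (6 * x (Suc k))\<^sup>2 * B k powr (2 - m) * A"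
          using A by (intro mult_left_mono) auto
        finally show ?thesis using False by (simp add: v_def)
      qed
      then show "mean (\<lambda>z. (if multiplier z \<le> \<rho> k powr (- 1 / m)
          then excess_loss fs ?a z - excess_loss fs ?b z else 0)\<^sup>2) \<le> v k" by (simp only: B_def)
    qed (use A m multiplier_pos multiplier_integrable multiplier_powr_integrable Nt \<pi> xp ent_le \<rho>p vp
        multiplier_measurable in auto)
    then obtain V where V: "integrable \<Omega> V"
      "\<forall>f\<in>G. \<forall>\<omega>\<in>space \<Omega>. \<bar>dev n (excess_loss fs f) \<omega>\<bar> \<le> V \<omega>"
      "expectation V \<le> (\<Sum>k<K. 2 * (1 + A) * (6 * x (Suc k) * \<rho> k powr (1 - 1 / m)) + 2 * sqrt (\<rho> k * v k))
        + 2 * (2 * x K) * mean multiplier" by blast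
    have "(\<Sum>k<K. 2 * (1 + A) * (6 * x (Suc k) * \<rho> k powr (1 - 1 / m)) + 2 * sqrt (\<rho> k * v k))
        \<le> (\<Sum>k<K. C2 * \<Lambda> * (t * \<delta>))"
    proof (rule sum_mono)
      fix k assume "k \<in> {..<K}"
      then have k: "k < K" by simp
      have "2 * (1 + A) * (6 * x (Suc k) * \<rho> k powr (1 - 1 / m)) = 12 * (1 + A) * (x (Suc k) * \<rho> k powr q)"
        by (simp add: q_def)
      also have "\<dots> \<le> 12 * (1 + A) * (\<Lambda> * ((2 powr \<gamma> + c) * (t * \<delta>)))"
        using A pq[OF k] by (intro mult_left_mono) auto
      finally show "2 * (1 + A) * (6 * x (Suc k) * \<rho> k powr (1 - 1 / m)) + 2 * sqrt (\<rho> k * v k)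
          \<le> C2 * \<Lambda> * (t * \<delta>)"
        using sv[OF k] unfolding C2_def by (simp add: algebra_simps)
    qed
    also have "\<dots> = real K * (C2 * \<Lambda> * (t * \<delta>))" by simp
    also have "\<dots> \<le> C3 * l * (C2 * \<Lambda> * (t * \<delta>))"
      using Kl C2 \<Lambda> tp \<delta> by (intro mult_right_mono mult_nonneg_nonneg) auto
    also have "\<dots> = C3 * (C2 * C\<Lambda>) * (l powr (a0 + 1) * (t * \<delta>))"
      using l by (simp add: \<Lambda>_def powr_add mult_ac)
    finally have s1: "(\<Sum>k<K. 2 * (1 + A) * (6 * x (Suc k) * \<rho> k powr (1 - 1 / m)) + 2 * sqrt (\<rho> k * v k))
        \<le> C3 * (C2 * C\<Lambda>) * (l powr (a0 + 1) * (t * \<delta>))" .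
    have l1: "l powr (a0 + 1) \<ge> 1" using l \<open>a0 \<ge> 0\<close> by (intro ge_one_powr_ge_zero) auto
    have s2: "2 * (2 * x K) * mean multiplier \<le> (4 * E + 1) * (l powr (a0 + 1) * (t * \<delta>))"
    proof -
      have "2 * (2 * x K) * mean multiplier = 4 * E * x K" by (simp add: E_def)
      also have "\<dots> \<le> 4 * E * (t * \<delta>)" using xK E by (intro mult_left_mono) auto
      also have "\<dots> \<le> (4 * E + 1) * (l powr (a0 + 1) * (t * \<delta>))"
        by (rule mult_mono) (use l1 t\<delta> E mult_right_mono[OF l1, of "t * \<delta>"] in auto)
      finally show ?thesis .
    qed
    have "expectation V \<le> C * l powr (a0 + 1) * (t * \<delta>)"
      using V(3) s1 s2 unfolding C_def by (simp add: algebra_simps)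
    with V(1,2) show ?thesis unfolding G_def l_def by blast
  qed
  with C show ?thesis by blast
qed

section \<open>The oracle inequality\<close>

lemma empirical_risk_diff:
  "empirical_risk n (\<lambda>i. X i \<omega>) (\<lambda>i. Y i \<omega>) f - empirical_risk n (\<lambda>i. X i \<omega>) (\<lambda>i. Y i \<omega>) fs
    = (\<Sum>i<n. excess_loss fs f (X i \<omega>, Y i \<omega>)) / real n"
  by (simp add: empirical_risk_def excess_loss_def sum_subtractf diff_divide_distrib)

lemma L2_norm_diff_quasi_triangle:
  assumes "admissible f" "admissible g" "admissible h"
  shows "L2_norm P (\<lambda>x. f x - h x) \<le> 2 * L2_norm P (\<lambda>x. f x - g x) + 2 * L2_norm P (\<lambda>x. h x - g x)"
proof (rule power2_le_imp_le)
  let ?a = "L2_norm P (\<lambda>x. f x - g x)" and ?b = "L2_norm P (\<lambda>x. h x - g x)"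
  have "0 \<le> ?a * ?b" by (intro mult_nonneg_nonneg L2_norm_nonneg)
  then have "2 * ?a\<^sup>2 + 2 * ?b\<^sup>2 \<le> (2 * ?a + 2 * ?b)\<^sup>2"
    by (simp add: power2_eq_square algebra_simps)
  then show "(L2_norm P (\<lambda>x. f x - h x))\<^sup>2 \<le> (2 * ?a + 2 * ?b)\<^sup>2"
    using L2_norm_diff_square_quasi_triangle[OF assms] by linarith
qed (intro add_nonneg_nonneg mult_nonneg_nonneg L2_norm_nonneg; simp)

lemma L2_norm_diff_commute: "L2_norm P (\<lambda>x. f x - g x) = L2_norm P (\<lambda>x. g x - f x)"
  by (simp add: L2_norm_def power2_commute)

lemma L2_norm_diff_bounded:
  assumes "admissible f" "admissible g"
  shows "L2_norm P (\<lambda>x. f x - g x) \<le> 2 * M"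
proof (rule L2_norm_diff_le[OF assms])
  fix x assume "x \<in> space S"
  then have "\<bar>f x\<bar> \<le> M" "\<bar>g x\<bar> \<le> M" using assms by (auto simp: admissible_def)
  then show "\<bar>f x - g x\<bar> \<le> 2 * M" by linarith
qed (use M in simp)

text \<open>If \<open>\<parallel>f - fs\<parallel>\<close> exceeds \<open>\<delta>\<close> it lies in a dyadic shell, between \<open>t / 2\<close> and \<open>t = 2 ^ k * \<delta>\<close>,
  and the comparison of empirical risks gives \<open>t\<^sup>2 \<le> 16 r\<^sup>2 + 8 V k\<close> with \<open>r = \<parallel>fs - f0\<parallel>\<close>. Division by \<open>t\<close>
  turns this into a bound that is linear in \<open>V k\<close>, so that expectations of the \<open>V k\<close> are all that is needed. The
  sum over all shells avoids the dependence of \<open>k\<close> on the sample.\<close>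

lemma peeling:
  assumes adm: "admissible f0" "admissible f" "admissible fs" and "\<omega> \<in> space \<Omega>"
    and risk: "empirical_risk n (\<lambda>i. X i \<omega>) (\<lambda>i. Y i \<omega>) f \<le> empirical_risk n (\<lambda>i. X i \<omega>) (\<lambda>i. Y i \<omega>) fs"
    and "\<delta> > 0" and J: "finite J" "\<And>k. 2 ^ k * \<delta> \<le> 4 * M \<Longrightarrow> k \<in> J"
    and V: "\<And>k. k \<in> J \<Longrightarrow> L2_norm P (\<lambda>x. f x - fs x) \<le> 2 ^ k * \<delta> \<Longrightarrow> \<bar>dev n (excess_loss fs f) \<omega>\<bar> \<le> V k"
      "\<And>k. k \<in> J \<Longrightarrow> V k \<ge> 0"
  shows "L2_norm P (\<lambda>x. f x - f0 x)
    \<le> 2 * \<delta> + 10 * L2_norm P (\<lambda>x. fs x - f0 x) + 16 * (\<Sum>k\<in>J. V k / (2 ^ k * \<delta>))"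
proof -
  define r where "r = L2_norm P (\<lambda>x. fs x - f0 x)"
  define g where "g = L2_norm P (\<lambda>x. f x - fs x)"
  define e where "e = L2_norm P (\<lambda>x. f x - f0 x)"
  have r0: "r \<ge> 0" by (simp add: r_def L2_norm_nonneg)
  have e2: "e \<le> 2 * g + 2 * r"
    using L2_norm_diff_quasi_triangle[OF adm(2,3,1)] by (simp add: e_def g_def r_def L2_norm_diff_commute[of f0])
  have nn: "V k / (2 ^ k * \<delta>) \<ge> 0" if "k \<in> J" for k using V(2)[OF that] \<open>\<delta> > 0\<close> by simp
  have sum0: "(\<Sum>k\<in>J. V k / (2 ^ k * \<delta>)) \<ge> 0" by (rule sum_nonneg[OF nn])
  show ?thesis
  proof (cases "g \<le> \<delta>")
    case True
    then show ?thesis using e2 r0 sum0 unfolding e_def r_def by linarith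
  next
    case False
    obtain k0 where "g / \<delta> < 2 ^ k0" using real_arch_pow[of 2 "g / \<delta>"] by auto
    then have k0: "g \<le> 2 ^ k0 * \<delta>" using \<open>\<delta> > 0\<close> by (simp add: field_simps)
    define k where "k = (LEAST k. g \<le> 2 ^ k * \<delta>)"
    have k: "g \<le> 2 ^ k * \<delta>" unfolding k_def by (rule LeastI[where P = "\<lambda>k. g \<le> 2 ^ k * \<delta>", OF k0])
    then obtain j where j: "k = Suc j" using False by (cases k) auto
    have "\<not> g \<le> 2 ^ j * \<delta>" using not_less_Least[of j "\<lambda>k. g \<le> 2 ^ k * \<delta>"] j by (simp add: k_def)
    then have t2: "2 ^ k * \<delta> < 2 * g" by (simp add: j)
    define t where "t = 2 ^ k * \<delta>"
    have t: "t > 0" "g \<le> t" "t < 2 * g" using \<open>\<delta> > 0\<close> k t2 by (auto simp: t_def)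
    have "g \<le> 2 * M" unfolding g_def by (rule L2_norm_diff_bounded[OF adm(2,3)])
    then have kJ: "k \<in> J" using t2 by (intro J(2)) linarith
    have Vk: "\<bar>dev n (excess_loss fs f) \<omega>\<bar> \<le> V k" using V(1)[OF kJ] k by (simp add: g_def)
    have "(\<Sum>i<n. excess_loss fs f (X i \<omega>, Y i \<omega>)) / real n \<le> 0"
      using risk by (simp add: empirical_risk_diff[symmetric])
    then have "mean (excess_loss fs f) \<le> V k" using Vk unfolding dev_def by linarith
    then have "e\<^sup>2 \<le> r\<^sup>2 + V k"
      using mean_excess_loss[OF adm] by (simp add: e_def r_def)
    moreover have "g\<^sup>2 \<le> 2 * e\<^sup>2 + 2 * r\<^sup>2"
      using L2_norm_diff_square_quasi_triangle[OF adm(2,1,3)] by (simp add: e_def g_def r_def)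
    moreover have "t\<^sup>2 \<le> 4 * g\<^sup>2"
    proof -
      have "t\<^sup>2 \<le> (2 * g)\<^sup>2" using t by (intro power_mono) auto
      then show ?thesis by (simp add: power_mult_distrib)
    qed
    ultimately have t_sq: "t\<^sup>2 \<le> 16 * r\<^sup>2 + 8 * V k" by linarith
    have tle: "t \<le> 4 * r + 8 * (V k / t)"
    proof (cases "t \<le> 4 * r")
      case True
      then show ?thesis using nn[OF kJ] by (simp add: t_def)
    next
      case False
      then have "(4 * r) * (4 * r) \<le> (4 * r) * t" using r0 by (intro mult_left_mono) auto
      then have "t * t \<le> (4 * r) * t + 8 * V k" using t_sq by (simp add: power2_eq_square)
      then have "(t * t) / t \<le> ((4 * r) * t + 8 * V k) / t" using t by (intro divide_right_mono) auto
      then show ?thesis using t by (simp add: add_divide_distrib)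
    qed
    have "V k / t \<le> (\<Sum>k\<in>J. V k / (2 ^ k * \<delta>))"
      unfolding t_def using member_le_sum[OF kJ, of "\<lambda>k. V k / (2 ^ k * \<delta>)"] nn J(1) by simp
    then have "e \<le> 10 * r + 16 * (\<Sum>k\<in>J. V k / (2 ^ k * \<delta>))" using e2 t tle by linarith
    then show ?thesis using \<open>\<delta> > 0\<close> by (simp add: e_def r_def)
  qed
qed

text \<open>Each shell contributes \<open>V k / (2 ^ k * \<delta>)\<close>, which \<open>localised_deviation\<close> bounds by \<open>\<delta>\<close> times a
  power of \<open>log n\<close>, whatever the shell. For \<open>n < D\<close> the rates exceed \<open>1\<close> and uniform boundedness
  suffices.\<close>

lemma oracle_inequality:
  assumes par: "\<gamma> \<ge> 0" "C0 > 0" "U \<ge> 1" "a0 \<ge> 0" "0 \<le> s" "s \<le> 1"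
  shows "\<exists>C>0. \<exists>a\<ge>0. \<forall>n\<ge>1. \<forall>F D fhat.
    regular_class \<gamma> C0 U a0 s C1 F D \<longrightarrow>
    (\<forall>\<omega>\<in>space \<Omega>. is_arg_min (empirical_risk n (\<lambda>i. X i \<omega>) (\<lambda>i. Y i \<omega>)) (\<lambda>f. f \<in> F) (fhat \<omega>)) \<longrightarrow>
    (\<lambda>\<omega>. L2_norm P (\<lambda>x. fhat \<omega> x - f0 x)) \<in> borel_measurable \<Omega> \<longrightarrow>
    expectation (\<lambda>\<omega>. L2_norm P (\<lambda>x. fhat \<omega> x - f0 x))
      \<le> C * log_plus (real n) powr a *
        ((real n / D) powr (- entropy_exponent \<gamma>) + (real n / D) powr (- heavy_tail_exponent m s \<gamma>)
          + (INF f\<in>F. L2_norm P (\<lambda>x. f x - f0 x)))"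
proof -
  define T where "T = 4 * M + 1"
  have T: "T \<ge> 1" using M by (simp add: T_def)
  obtain B where B: "B > 0" and loc: "\<And>n F D fs \<delta> t. n \<ge> 1 \<Longrightarrow> D \<le> real n \<Longrightarrow>
    regular_class \<gamma> C0 U a0 s C1 F D \<Longrightarrow> fs \<in> F \<Longrightarrow>
    0 < \<delta> \<Longrightarrow> \<delta> \<le> 2 \<Longrightarrow> 1 / real n \<le> \<delta>\<^sup>2 \<Longrightarrow> 1 / (real n / D) \<le> \<delta> powr (2 * \<gamma>) \<Longrightarrow>
    1 / (real n / D) \<le> \<delta> powr (2 + \<gamma>) \<Longrightarrow>
    1 / (real n / D) \<le> \<delta> powr ((2 - s) / (1 - 1 / m) + s * \<gamma>) \<Longrightarrow>
    \<delta> \<le> t \<Longrightarrow> t \<le> T \<Longrightarrow>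
    (\<exists>V. integrable \<Omega> V \<and>
      (\<forall>f\<in>L2_ball F fs t. \<forall>\<omega>\<in>space \<Omega>. \<bar>dev n (excess_loss fs f) \<omega>\<bar> \<le> V \<omega>) \<and>
      expectation V \<le> B * log_plus (real n) powr (a0 + 1) * (t * \<delta>))"
    using localised_deviation[OF par T, of C1] by blast
  define b where "b = 3 + 2 * ln T"
  have b: "b \<ge> 1" using T by (simp add: b_def)
  define a where "a = a0 + 2"
  \<comment> \<open>\<open>2 M\<close> serves the case \<open>n < D\<close>, \<open>12\<close> the terms \<open>2 \<delta>\<close> and \<open>10 \<parallel>fs - f0\<parallel>\<close> of \<open>peeling\<close>, and \<open>16 b B\<close> its sum over \<open>O(b log n)\<close> shells\<close>
  define C where "C = 2 * M + 12 + 16 * b * B"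
  have C: "C > 0" using M b B by (simp add: C_def add_pos_pos)
  have a: "a \<ge> 0" using par by (simp add: a_def)
  have "expectation (\<lambda>\<omega>. L2_norm P (\<lambda>x. fhat \<omega> x - f0 x))
      \<le> C * log_plus (real n) powr a *
        ((real n / D) powr (- entropy_exponent \<gamma>) + (real n / D) powr (- heavy_tail_exponent m s \<gamma>)
          + (INF f\<in>F. L2_norm P (\<lambda>x. f x - f0 x)))"
    if n: "n \<ge> 1" and reg: "regular_class \<gamma> C0 U a0 s C1 F D"
      and argmin: "\<And>\<omega>. \<omega> \<in> space \<Omega> \<Longrightarrow>
        is_arg_min (empirical_risk n (\<lambda>i. X i \<omega>) (\<lambda>i. Y i \<omega>)) (\<lambda>f. f \<in> F) (fhat \<omega>)"
      and meas: "(\<lambda>\<omega>. L2_norm P (\<lambda>x. fhat \<omega> x - f0 x)) \<in> borel_measurable \<Omega>"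
    for n F D fhat
  proof -
    have D1: "D \<ge> 1" and adm: "\<And>f. f \<in> F \<Longrightarrow> admissible f" and adm0: "admissible f0"
      using reg by (auto simp: regular_class_def)
    have fhat: "fhat \<omega> \<in> F" if "\<omega> \<in> space \<Omega>" for \<omega> using argmin[OF that] by (simp add: is_arg_min_def)
    have Fne: "F \<noteq> {}" using fhat not_empty by blast
    define l where "l = log_plus (real n)"
    have l: "l \<ge> 1" by (simp add: l_def log_plus_ge)
    define err where "err \<omega> = L2_norm P (\<lambda>x. fhat \<omega> x - f0 x)" for \<omega>
    have err: "0 \<le> err \<omega>" "\<omega> \<in> space \<Omega> \<Longrightarrow> err \<omega> \<le> 2 * M" for \<omega>
      using L2_norm_diff_bounded[OF adm[OF fhat] adm0] by (auto simp: err_def L2_norm_nonneg)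
    have ierr: "integrable \<Omega> err"
      by (rule integrable_const_bound[where B = "2 * M"]) (use err meas in \<open>auto simp: err_def[abs_def]\<close>)
    define app where "app = (INF f\<in>F. L2_norm P (\<lambda>x. f x - f0 x))"
    have app: "app \<ge> 0" unfolding app_def by (rule cINF_greatest[OF Fne L2_norm_nonneg])
    define \<delta> where "\<delta> = (real n / D) powr (- entropy_exponent \<gamma>) + (real n / D) powr (- heavy_tail_exponent m s \<gamma>)"
    have la: "l powr a \<ge> 1" using l a by (rule ge_one_powr_ge_zero)
    have \<delta>0: "\<delta> \<ge> 0" by (simp add: \<delta>_def)
    have "expectation err \<le> C * l powr a * (\<delta> + app)"
    proof (cases "D \<le> real n")
      case False
      have "expectation err \<le> expectation (\<lambda>_. 2 * M)"
        using ierr err by (intro integral_mono) auto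
      then have E: "expectation err \<le> 2 * M" by (simp add: prob_space)
      have "0 < real n / D" "real n / D \<le> 1" using False n D1 by auto
      moreover have "0 \<le> entropy_exponent \<gamma>" using par by (auto simp: entropy_exponent_def)
      ultimately have "1 \<le> (real n / D) powr (- entropy_exponent \<gamma>)"
        using powr_mono2'[of "- entropy_exponent \<gamma>" "real n / D" 1] by simp
      then have \<delta>1: "1 \<le> \<delta>" by (simp add: \<delta>_def add_increasing2)
      have "2 * M \<le> C" using b B by (simp add: C_def)
      then have "2 * M * 1 * 1 \<le> C * l powr a * (\<delta> + app)"
        using la \<delta>1 app M C by (intro mult_mono mult_nonneg_nonneg) auto
      with E show ?thesis by simp
    next
      case True
      note cr = critical_radius[OF D1 True par(1,5,6) m, folded \<delta>_def]
      have \<delta>: "\<delta> > 0" by (rule cr(1))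
      have \<delta>n: "1 / real n \<le> \<delta>"
      proof (rule ccontr)
        assume "\<not> 1 / real n \<le> \<delta>"
        then have lt: "\<delta> < 1 / real n" by simp
        have "\<delta> * \<delta> < 1 * (1 / real n)"
          using lt \<delta> n by (intro mult_strict_mono) (auto simp: less_le_trans[OF lt] field_simps intro: less_le_trans[OF lt])
        with cr(3) show False by (simp add: power2_eq_square)
      qed
      define J where "J = {k. 2 ^ k * \<delta> \<le> 4 * M}"
      have kb: "real k \<le> (2 + 2 * ln T) * l" if "k \<in> J" for k unfolding l_def
      proof (rule dyadic_count[OF _ T])
        have "2 ^ k * (1 / real n) \<le> 2 ^ k * \<delta>" using \<delta>n by (intro mult_left_mono) auto
        also have "\<dots> \<le> T" using that by (simp add: J_def T_def)
        finally show "2 ^ k \<le> T * real n" using n by (simp add: field_simps)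
      qed (use n in simp)
      have Jsub: "J \<subseteq> {..nat \<lfloor>(2 + 2 * ln T) * l\<rfloor>}" using kb by (auto simp: le_nat_floor)
      have finJ: "finite J" by (rule finite_subset[OF Jsub]) simp
      have cardJ: "real (card J) \<le> b * l"
      proof -
        have nn: "0 \<le> (2 + 2 * ln T) * l" using T l by (intro mult_nonneg_nonneg) auto
        have "card J \<le> nat \<lfloor>(2 + 2 * ln T) * l\<rfloor> + 1" using card_mono[OF _ Jsub] by simp
        then have "real (card J) \<le> real (nat \<lfloor>(2 + 2 * ln T) * l\<rfloor>) + 1" by linarith
        also have "\<dots> \<le> (2 + 2 * ln T) * l + l" using of_nat_floor[OF nn] l by linarith
        finally show ?thesis by (simp add: b_def algebra_simps)
      qed
      \<comment> \<open>the infimum over the class need not be attained, so \<open>fs\<close> is arbitrary\<close>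
      have bound: "expectation err \<le> C * l powr a * \<delta> + 10 * L2_norm P (\<lambda>x. fs x - f0 x)" if fs: "fs \<in> F" for fs
      proof -
        define dominates where "dominates k V \<longleftrightarrow> integrable \<Omega> V \<and>
          (\<forall>f\<in>L2_ball F fs (2 ^ k * \<delta>). \<forall>\<omega>\<in>space \<Omega>. \<bar>dev n (excess_loss fs f) \<omega>\<bar> \<le> V \<omega>) \<and>
          expectation V \<le> B * l powr (a0 + 1) * (2 ^ k * \<delta> * \<delta>)" for k V
        have "\<exists>V. dominates k V" if "k \<in> J" for k
          unfolding dominates_def l_def
        proof (rule loc[OF n True reg fs cr])
          show "\<delta> \<le> 2 ^ k * \<delta>" using \<delta> by simp
          show "2 ^ k * \<delta> \<le> T" using that by (simp add: J_def T_def)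
        qed
        then obtain V where "\<And>k. k \<in> J \<Longrightarrow> dominates k (V k)" by metis
        then have V: "\<And>k. k \<in> J \<Longrightarrow> integrable \<Omega> (V k)"
          "\<And>k f \<omega>. k \<in> J \<Longrightarrow> f \<in> L2_ball F fs (2 ^ k * \<delta>) \<Longrightarrow> \<omega> \<in> space \<Omega> \<Longrightarrow> \<bar>dev n (excess_loss fs f) \<omega>\<bar> \<le> V k \<omega>"
          "\<And>k. k \<in> J \<Longrightarrow> expectation (V k) \<le> B * l powr (a0 + 1) * (2 ^ k * \<delta> * \<delta>)"
          unfolding dominates_def by blast+
        let ?R = "\<lambda>\<omega>. 2 * \<delta> + 10 * L2_norm P (\<lambda>x. fs x - f0 x) + 16 * (\<Sum>k\<in>J. V k \<omega> / (2 ^ k * \<delta>))"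
        have fsb: "fs \<in> L2_ball F fs (2 ^ k * \<delta>)" for k
          using fs \<delta> by (simp add: L2_ball_def L2_norm_def)
        have pw: "err \<omega> \<le> ?R \<omega>" if \<omega>: "\<omega> \<in> space \<Omega>" for \<omega>
          unfolding err_def
        proof (rule peeling[OF adm0 adm[OF fhat[OF \<omega>]] adm[OF fs] \<omega> _ \<delta> finJ])
          show "empirical_risk n (\<lambda>i. X i \<omega>) (\<lambda>i. Y i \<omega>) (fhat \<omega>) \<le> empirical_risk n (\<lambda>i. X i \<omega>) (\<lambda>i. Y i \<omega>) fs"
            using argmin[OF \<omega>] fs by (auto simp: is_arg_min_def not_less)
          show "k \<in> J" if "2 ^ k * \<delta> \<le> 4 * M" for k using that by (simp add: J_def)
          show "\<bar>dev n (excess_loss fs (fhat \<omega>)) \<omega>\<bar> \<le> V k \<omega>"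
            if "k \<in> J" "L2_norm P (\<lambda>x. fhat \<omega> x - fs x) \<le> 2 ^ k * \<delta>" for k
            using V(2)[OF that(1) _ \<omega>] fhat[OF \<omega>] that(2) by (simp add: L2_ball_def)
          show "0 \<le> V k \<omega>" if "k \<in> J" for k
            by (rule order_trans[OF abs_ge_zero V(2)[OF that fsb \<omega>]])
        qed
        have iR: "integrable \<Omega> ?R" using V(1) by simp
        have "expectation err \<le> expectation ?R" by (rule integral_mono[OF ierr iR pw])
        also have "\<dots> = 2 * \<delta> + 10 * L2_norm P (\<lambda>x. fs x - f0 x)
            + 16 * (\<Sum>k\<in>J. expectation (V k) / (2 ^ k * \<delta>))"
          using V(1) by (simp add: prob_space Bochner_Integration.integral_sum)
        also have "(\<Sum>k\<in>J. expectation (V k) / (2 ^ k * \<delta>)) \<le> (\<Sum>k\<in>J. B * l powr (a0 + 1) * \<delta>)"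
        proof (rule sum_mono)
          fix k assume k: "k \<in> J"
          have "expectation (V k) / (2 ^ k * \<delta>) \<le> B * l powr (a0 + 1) * (2 ^ k * \<delta> * \<delta>) / (2 ^ k * \<delta>)"
            using V(3)[OF k] \<delta> by (intro divide_right_mono) auto
          then show "expectation (V k) / (2 ^ k * \<delta>) \<le> B * l powr (a0 + 1) * \<delta>" using \<delta> by simp
        qed
        also have "(\<Sum>k\<in>J. B * l powr (a0 + 1) * \<delta>) = real (card J) * (B * l powr (a0 + 1) * \<delta>)" by simp
        also have "\<dots> \<le> (b * l) * (B * l powr (a0 + 1) * \<delta>)"
          using cardJ B \<delta> by (intro mult_right_mono mult_nonneg_nonneg) auto
        also have "\<dots> = b * B * (l powr a * \<delta>)"
        proof -
          have "l powr a = l * l powr (a0 + 1)" using l powr_mult_base[of l "a0 + 1"] by (simp add: a_def add.commute)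
          then show ?thesis by (simp add: mult_ac)
        qed
        finally have "expectation err \<le> 2 * \<delta> + 10 * L2_norm P (\<lambda>x. fs x - f0 x) + 16 * (b * B * (l powr a * \<delta>))"
          by simp
        moreover have "2 * \<delta> \<le> (2 * M + 12) * (l powr a * \<delta>)"
          by (rule mult_mono) (use M la \<delta> mult_right_mono[OF la, of \<delta>] in auto)
        ultimately show ?thesis unfolding C_def by (simp add: algebra_simps)
      qed
      have "(expectation err - C * l powr a * \<delta>) / 10 \<le> app" unfolding app_def
        using bound by (intro cINF_greatest[OF Fne]) (simp add: field_simps)
      then have "expectation err \<le> C * l powr a * \<delta> + 10 * app" by simp
      also have "10 * app \<le> C * l powr a * app"
      proof (rule mult_right_mono[OF _ app])
        have "10 * 1 \<le> C * l powr a"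
          by (rule mult_mono) (use la C M b B in \<open>auto simp: C_def\<close>)
        then show "10 \<le> C * l powr a" by simp
      qed
      finally show ?thesis by (simp add: algebra_simps)
    qed
    then show ?thesis by (simp add: err_def[abs_def] l_def \<delta>_def app_def)
  qed
  with C a show ?thesis by blast
qed

end

section \<open>From conditional moments of the noise to the rate\<close>

lemma (in prob_space) sigma_gen_subalgebra:
  assumes "Z \<in> M \<rightarrow>\<^sub>M S"
  shows "finite_measure_subalgebra M (sigma_gen M S Z)"
proof -
  have "sets (vimage_algebra (space M) Z S) \<subseteq> sets M"
    unfolding sets_vimage_algebra
    by (rule sets.sigma_sets_subset) (use assms in \<open>auto simp: measurable_sets\<close>)
  then have "subalgebra M (sigma_gen M S Z)" by (simp add: subalgebra_def sigma_gen_def)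
  then show ?thesis
    by (simp add: finite_measure_subalgebra_def finite_measure_subalgebra_axioms_def finite_measure_axioms)
qed

text \<open>A bounded function of \<open>Z\<close> is measurable with respect to the \<open>\<sigma>\<close>-algebra generated by \<open>Z\<close>, so it can be
  pulled through the conditional expectation.\<close>

lemma (in prob_space) expectation_factor_cond_exp:
  assumes Z [measurable]: "Z \<in> M \<rightarrow>\<^sub>M S" and u: "integrable M u"
    and h [measurable]: "h \<in> borel_measurable S" and hb: "\<And>x. x \<in> space S \<Longrightarrow> \<bar>h x\<bar> \<le> b"
  shows "integrable M (\<lambda>\<omega>. h (Z \<omega>) * u \<omega>)"
    and "integrable M (\<lambda>\<omega>. h (Z \<omega>) * real_cond_exp M (sigma_gen M S Z) u \<omega>)"
    and "expectation (\<lambda>\<omega>. h (Z \<omega>) * real_cond_exp M (sigma_gen M S Z) u \<omega>) = expectation (\<lambda>\<omega>. h (Z \<omega>) * u \<omega>)"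
proof -
  interpret finite_measure_subalgebra M "sigma_gen M S Z" by (rule sigma_gen_subalgebra[OF Z])
  have [measurable]: "u \<in> borel_measurable M" using u by simp
  have Zs: "Z \<omega> \<in> space S" if "\<omega> \<in> space M" for \<omega> by (rule measurable_space[OF Z that])
  show i: "integrable M (\<lambda>\<omega>. h (Z \<omega>) * u \<omega>)"
  proof (rule Bochner_Integration.integrable_bound)
    show "integrable M (\<lambda>\<omega>. \<bar>b\<bar> * \<bar>u \<omega>\<bar>)" using u by simp
    show "AE \<omega> in M. norm (h (Z \<omega>) * u \<omega>) \<le> norm (\<bar>b\<bar> * \<bar>u \<omega>\<bar>)"
    proof (rule AE_I2)
      fix \<omega> assume "\<omega> \<in> space M"
      then have "\<bar>h (Z \<omega>)\<bar> \<le> \<bar>b\<bar>" using hb[OF Zs] by force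
      then show "norm (h (Z \<omega>) * u \<omega>) \<le> norm (\<bar>b\<bar> * \<bar>u \<omega>\<bar>)" by (simp add: abs_mult mult_right_mono)
    qed
  qed measurable
  have "Z \<in> sigma_gen M S Z \<rightarrow>\<^sub>M S" unfolding sigma_gen_def
    by (rule measurable_vimage_algebra1) (use Zs in auto)
  then have "(\<lambda>\<omega>. h (Z \<omega>)) \<in> borel_measurable (sigma_gen M S Z)" by (rule measurable_compose[OF _ h])
  from real_cond_exp_intg[OF i this] u
  show "integrable M (\<lambda>\<omega>. h (Z \<omega>) * real_cond_exp M (sigma_gen M S Z) u \<omega>)"
    and "expectation (\<lambda>\<omega>. h (Z \<omega>) * real_cond_exp M (sigma_gen M S Z) u \<omega>) = expectation (\<lambda>\<omega>. h (Z \<omega>) * u \<omega>)"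
    by auto
qed

theorem theorem5p3:
  fixes \<Omega> :: "'w measure" and S :: "'x measure" and P :: "'x measure"
    and X :: "nat \<Rightarrow> 'w \<Rightarrow> 'x" and Y :: "nat \<Rightarrow> 'w \<Rightarrow> real" and \<xi> :: "nat \<Rightarrow> 'w \<Rightarrow> real"
    and f0 :: "'x \<Rightarrow> real"
    and m \<kappa> M \<gamma> C0 U a0 s C1 :: real
  assumes "prob_space \<Omega>"
    and "iid \<Omega> (S \<Otimes>\<^sub>M borel) (\<lambda>i \<omega>. (X i \<omega>, Y i \<omega>))"
    and "P = distr \<Omega> S (X 0)"
    and "f0 \<in> borel_measurable S"
    and "\<And>i \<omega>. \<omega> \<in> space \<Omega> \<Longrightarrow> Y i \<omega> = f0 (X i \<omega>) + \<xi> i \<omega>"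
    and "\<And>i. AE \<omega> in \<Omega>. real_cond_exp \<Omega> (sigma_gen \<Omega> S (X i)) (\<xi> i) \<omega> = 0"
    and "m > 1" and "0 < \<kappa>" and "\<kappa> \<le> 1" and "min m 2 = 1 + \<kappa>"
    and "\<And>i. integrable \<Omega> (\<lambda>\<omega>. \<bar>\<xi> i \<omega>\<bar> powr m)"
    and "\<And>i. esssup \<Omega> (\<lambda>\<omega>. ereal \<bar>real_cond_exp \<Omega> (sigma_gen \<Omega> S (X i))
              (\<lambda>\<omega>'. \<bar>\<xi> i \<omega>'\<bar> powr (1 + \<kappa>)) \<omega>\<bar>) < \<infinity>"
    and "M > 0" and "\<gamma> \<ge> 0" and "C0 > 0" and "U \<ge> 1" and "a0 \<ge> 0"
    and "0 \<le> s" and "s \<le> 1"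
  shows "\<exists>C>0. \<exists>a\<ge>0. \<forall>n\<ge>1. \<forall>(F :: ('x \<Rightarrow> real) set) (D :: real) (fhat :: 'w \<Rightarrow> 'x \<Rightarrow> real).
           F \<subseteq> borel_measurable S \<longrightarrow>
           unif_bounded_class (space S) M (F \<union> {f0}) \<longrightarrow>
           D \<ge> 1 \<longrightarrow>
           entropy_condition (space S) \<gamma> C0 U a0 F D \<longrightarrow>
           envelope_condition P s C1 F \<longrightarrow>
           (\<forall>\<omega>\<in>space \<Omega>. is_arg_min (empirical_risk n (\<lambda>i. X i \<omega>) (\<lambda>i. Y i \<omega>))
                                    (\<lambda>f. f \<in> F) (fhat \<omega>)) \<longrightarrow>
           (\<lambda>\<omega>. L2_norm P (\<lambda>x. fhat \<omega> x - f0 x)) \<in> borel_measurable \<Omega> \<longrightarrow>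
           (\<integral>\<omega>. L2_norm P (\<lambda>x. fhat \<omega> x - f0 x) \<partial>\<Omega>)
             \<le> C * log_plus (real n) powr a *
                ((real n / D) powr (- entropy_exponent \<gamma>)
                 + (real n / D) powr (- (1 / ((2 - s) / (1 - 1 / m) + s * \<gamma>)))
                 + (INF f\<in>F. L2_norm P (\<lambda>x. f x - f0 x)))"
proof -
  interpret \<Omega>: prob_space \<Omega> by (rule assms(1))
  define Z where "Z = (\<lambda>i \<omega>. (X i \<omega>, Y i \<omega>))"
  have iid: "\<Omega>.indep_vars (\<lambda>_. S \<Otimes>\<^sub>M borel) Z UNIV"
    "\<And>i j. distr \<Omega> (S \<Otimes>\<^sub>M borel) (Z i) = distr \<Omega> (S \<Otimes>\<^sub>M borel) (Z j)"
    using assms(2) by (auto simp: iid_def Z_def)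
  have Zm: "Z 0 \<in> \<Omega> \<rightarrow>\<^sub>M (S \<Otimes>\<^sub>M borel)" using iid(1) by (auto simp: \<Omega>.indep_vars_def)
  have X0 [measurable]: "X 0 \<in> \<Omega> \<rightarrow>\<^sub>M S"
    using measurable_comp[OF Zm measurable_fst] by (simp add: Z_def comp_def)
  have Y0 [measurable]: "Y 0 \<in> borel_measurable \<Omega>"
    using measurable_comp[OF Zm measurable_snd] by (simp add: Z_def comp_def)
  note f0 [measurable] = assms(4)
  have \<xi>_eq: "\<xi> 0 \<omega> = Y 0 \<omega> - f0 (X 0 \<omega>)" if "\<omega> \<in> space \<Omega>" for \<omega> using assms(5)[OF that, of 0] by simp
  have \<xi>m [measurable]: "\<xi> 0 \<in> borel_measurable \<Omega>"
    by (subst measurable_cong[OF \<xi>_eq]) auto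
  note low = \<Omega>.integrable_lower_power[OF \<xi>m _ _ assms(11)[of 0]]
  have \<xi>i: "integrable \<Omega> (\<xi> 0)"
  proof -
    have "integrable \<Omega> (\<lambda>\<omega>. \<bar>\<xi> 0 \<omega>\<bar> powr 1)" by (rule low) (use \<open>m > 1\<close> in auto)
    then have "integrable \<Omega> (\<lambda>\<omega>. \<bar>\<xi> 0 \<omega>\<bar>)" by simp
    then show ?thesis by (rule integrable_abs_cancel) measurable
  qed
  let ?G = "sigma_gen \<Omega> S (X 0)"
  have orth: "\<Omega>.expectation (\<lambda>\<omega>. g (X 0 \<omega>) * (Y 0 \<omega> - f0 (X 0 \<omega>))) = 0"
    if g: "g \<in> borel_measurable S" "\<And>x. x \<in> space S \<Longrightarrow> \<bar>g x\<bar> \<le> b" for g b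
  proof -
    have "\<Omega>.expectation (\<lambda>\<omega>. g (X 0 \<omega>) * (Y 0 \<omega> - f0 (X 0 \<omega>))) = \<Omega>.expectation (\<lambda>\<omega>. g (X 0 \<omega>) * \<xi> 0 \<omega>)"
      by (intro Bochner_Integration.integral_cong) (auto simp: \<xi>_eq)
    also have "\<dots> = \<Omega>.expectation (\<lambda>\<omega>. g (X 0 \<omega>) * real_cond_exp \<Omega> ?G (\<xi> 0) \<omega>)"
      by (rule \<Omega>.expectation_factor_cond_exp(3)[OF X0 \<xi>i g, symmetric])
    also have "\<dots> = 0"
      by (rule integral_eq_zero_AE) (use assms(6)[of 0] in eventually_elim, simp)
    finally show ?thesis .
  qed
  have var: "\<exists>V. \<forall>g\<in>borel_measurable S. \<forall>b. (\<forall>x\<in>space S. \<bar>g x\<bar> \<le> b) \<longrightarrow>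
      \<Omega>.expectation (\<lambda>\<omega>. (g (X 0 \<omega>))\<^sup>2 * (Y 0 \<omega> - f0 (X 0 \<omega>))\<^sup>2)
        \<le> V * \<Omega>.expectation (\<lambda>\<omega>. (g (X 0 \<omega>))\<^sup>2)" if "m \<ge> 2"
  proof -
    have \<kappa>: "\<kappa> = 1" using assms(10) \<open>m \<ge> 2\<close> by simp
    define u where "u \<omega> = \<bar>\<xi> 0 \<omega>\<bar> powr (1 + \<kappa>)" for \<omega>
    have ui: "integrable \<Omega> u" unfolding u_def by (rule low) (use \<kappa> \<open>m \<ge> 2\<close> in auto)
    have u_eq: "u \<omega> = (Y 0 \<omega> - f0 (X 0 \<omega>))\<^sup>2" if "\<omega> \<in> space \<Omega>" for \<omega>
      using \<kappa> by (simp add: u_def \<xi>_eq[OF that] powr_numeral)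
    define e where "e = esssup \<Omega> (\<lambda>\<omega>. ereal \<bar>real_cond_exp \<Omega> ?G u \<omega>\<bar>)"
    have "e < \<infinity>" using assms(12)[of 0] by (simp add: e_def u_def[abs_def])
    then obtain V where V: "e \<le> ereal V" by (cases e) auto
    have bd: "AE \<omega> in \<Omega>. real_cond_exp \<Omega> ?G u \<omega> \<le> V"
      using esssup_AE[of "\<lambda>\<omega>. ereal \<bar>real_cond_exp \<Omega> ?G u \<omega>\<bar>" \<Omega>]
    proof eventually_elim
      case (elim \<omega>)
      then have "ereal \<bar>real_cond_exp \<Omega> ?G u \<omega>\<bar> \<le> ereal V" using V unfolding e_def by (rule order_trans)
      then show ?case by simp
    qed
    have "\<Omega>.expectation (\<lambda>\<omega>. (g (X 0 \<omega>))\<^sup>2 * (Y 0 \<omega> - f0 (X 0 \<omega>))\<^sup>2)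
        \<le> V * \<Omega>.expectation (\<lambda>\<omega>. (g (X 0 \<omega>))\<^sup>2)"
      if g [measurable]: "g \<in> borel_measurable S" and gb: "\<forall>x\<in>space S. \<bar>g x\<bar> \<le> b" for g b
    proof -
      have h: "(\<lambda>x. (g x)\<^sup>2) \<in> borel_measurable S" by measurable
      have hb: "\<bar>(g x)\<^sup>2\<bar> \<le> b\<^sup>2" if "x \<in> space S" for x
      proof -
        have "\<bar>g x\<bar> \<le> \<bar>b\<bar>" using gb that by force
        then show ?thesis by (simp add: abs_le_square_iff)
      qed
      note ce = \<Omega>.expectation_factor_cond_exp[OF X0 ui h hb]
      have ig: "integrable \<Omega> (\<lambda>\<omega>. (g (X 0 \<omega>))\<^sup>2)"
        by (rule \<Omega>.integrable_const_bound[where B = "b\<^sup>2"])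
          (use hb measurable_space[OF X0] in \<open>auto intro!: AE_I2\<close>)
      have "\<Omega>.expectation (\<lambda>\<omega>. (g (X 0 \<omega>))\<^sup>2 * (Y 0 \<omega> - f0 (X 0 \<omega>))\<^sup>2)
          = \<Omega>.expectation (\<lambda>\<omega>. (g (X 0 \<omega>))\<^sup>2 * u \<omega>)"
        by (intro Bochner_Integration.integral_cong) (auto simp: u_eq)
      also have "\<dots> = \<Omega>.expectation (\<lambda>\<omega>. (g (X 0 \<omega>))\<^sup>2 * real_cond_exp \<Omega> ?G u \<omega>)"
        by (rule ce(3)[symmetric])
      also have "\<dots> \<le> \<Omega>.expectation (\<lambda>\<omega>. (g (X 0 \<omega>))\<^sup>2 * V)"
      proof (rule integral_mono_AE[OF ce(2)])
        show "integrable \<Omega> (\<lambda>\<omega>. (g (X 0 \<omega>))\<^sup>2 * V)" using ig by simp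
        show "AE \<omega> in \<Omega>. (g (X 0 \<omega>))\<^sup>2 * real_cond_exp \<Omega> ?G u \<omega> \<le> (g (X 0 \<omega>))\<^sup>2 * V"
          using bd by eventually_elim (simp add: mult_left_mono)
      qed
      finally show ?thesis by (simp add: mult.commute)
    qed
    then show ?thesis by blast
  qed
  interpret R: heavy_tailed_regression \<Omega> S X Y f0 m M
  proof unfold_locales
    show "\<Omega>.indep_vars (\<lambda>_. S \<Otimes>\<^sub>M borel) (\<lambda>i \<omega>. (X i \<omega>, Y i \<omega>)) UNIV"
      using iid(1) by (simp add: Z_def)
    show "distr \<Omega> (S \<Otimes>\<^sub>M borel) (\<lambda>\<omega>. (X i \<omega>, Y i \<omega>)) = distr \<Omega> (S \<Otimes>\<^sub>M borel) (\<lambda>\<omega>. (X j \<omega>, Y j \<omega>))" for i j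
      using iid(2)[of i j] by (simp add: Z_def)
    show "integrable \<Omega> (\<lambda>\<omega>. \<bar>Y 0 \<omega> - f0 (X 0 \<omega>)\<bar> powr m)"
      using assms(11)[of 0] by (subst Bochner_Integration.integrable_cong[where g = "\<lambda>\<omega>. \<bar>\<xi> 0 \<omega>\<bar> powr m"])
        (auto simp: \<xi>_eq)
  qed (use f0 \<open>m > 1\<close> \<open>M > 0\<close> orth var in blast)+
  obtain C a where C: "C > 0" "a \<ge> 0" and bound: "\<And>n F D fhat. n \<ge> 1 \<Longrightarrow>
    R.regular_class \<gamma> C0 U a0 s C1 F D \<Longrightarrow>
    (\<forall>\<omega>\<in>space \<Omega>. is_arg_min (empirical_risk n (\<lambda>i. X i \<omega>) (\<lambda>i. Y i \<omega>)) (\<lambda>f. f \<in> F) (fhat \<omega>)) \<Longrightarrow>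
    (\<lambda>\<omega>. L2_norm R.P (\<lambda>x. fhat \<omega> x - f0 x)) \<in> borel_measurable \<Omega> \<Longrightarrow>
    \<Omega>.expectation (\<lambda>\<omega>. L2_norm R.P (\<lambda>x. fhat \<omega> x - f0 x))
      \<le> C * log_plus (real n) powr a *
        ((real n / D) powr (- entropy_exponent \<gamma>) + (real n / D) powr (- heavy_tail_exponent m s \<gamma>)
          + (INF f\<in>F. L2_norm R.P (\<lambda>x. f x - f0 x)))"
    using R.oracle_inequality[OF assms(14-19), of C1] by blast
  have reg: "R.regular_class \<gamma> C0 U a0 s C1 F D"
    if "F \<subseteq> borel_measurable S" "unif_bounded_class (space S) M (F \<union> {f0})" "D \<ge> 1"
      "entropy_condition (space S) \<gamma> C0 U a0 F D" "envelope_condition P s C1 F" for F D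
    using that f0 unfolding R.regular_class_def R.admissible_def unif_bounded_class_def assms(3) by blast
  show ?thesis
    by (intro exI[of _ C] exI[of _ a] conjI C allI impI, unfold assms(3) heavy_tail_exponent_def[symmetric],
        rule bound) (use reg in \<open>auto simp: assms(3)\<close>)
qed

end
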